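(* Let $G=(V,E)$ be a bridgeless graph such that all roots of $F(G,\lambda)$ are real. If either $|E|\le |V|+16$ or $|\mathcal R(G)|\le 8$, then every root of $F(G,\lambda)$ lies in $\{1,2,3\}$.
   Context: Graphs are finite, undirected, possibly with loops and parallel edges. The flow polynomial $F(G,\lambda)$ is determined by: $F(G,\lambda)=1$ if $E(G)=\emptyset$; $F(G,\lambda)=0$ if $G$ has a bridge; multiplicative over disjoint unions; $F(G,\lambda)=(\lambda-1)F(G-e,\lambda)$ if $e$ is a loop; otherwise $F(G,\lambda)=F(G/e,\lambda)-F(G-e,\lambda)$ ($G/e$ = contraction of $e$). $\mathcal R(G)$ is the multiset of real roots of $F(G,\lambda)$ in $(1,2)$, with $|\mathcal R(G)|$ its size counted with multiplicity. *)

theory Defs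
  imports Complex_Main "HOL-Computational_Algebra.Polynomial"
begin

text \<open>Finite undirected multigraphs (loops and parallel edges allowed).
  Each edge e has two (unordered) endpoints given by the pair ends e;
  a loop is an edge with equal endpoints.\<close>

record ('v, 'e) mgraph =
  verts :: "'v set"
  edges :: "'e set"
  ends  :: "'e \<Rightarrow> 'v \<times> 'v"

definition wf_mgraph :: "('v, 'e) mgraph \<Rightarrow> bool" where
  "wf_mgraph G \<longleftrightarrow> finite (verts G) \<and> finite (edges G) \<and>
     (\<forall>e\<in>edges G. fst (ends G e) \<in> verts G \<and> snd (ends G e) \<in> verts G)"

definition is_loop :: "('v, 'e) mgraph \<Rightarrow> 'e \<Rightarrow> bool" where
  "is_loop G e \<longleftrightarrow> fst (ends G e) = snd (ends G e)"

definition adj :: "('v, 'e) mgraph \<Rightarrow> 'v \<Rightarrow> 'v \<Rightarrow> bool" where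
  "adj G x y \<longleftrightarrow> (\<exists>e\<in>edges G. ends G e = (x, y) \<or> ends G e = (y, x))"

definition connected_in :: "('v, 'e) mgraph \<Rightarrow> 'v \<Rightarrow> 'v \<Rightarrow> bool" where
  "connected_in G x y \<longleftrightarrow> (x, y) \<in> {(a, b). adj G a b}\<^sup>*"

definition del_edge :: "('v, 'e) mgraph \<Rightarrow> 'e \<Rightarrow> ('v, 'e) mgraph" where
  "del_edge G e = G\<lparr>edges := edges G - {e}\<rparr>"

definition contr_edge :: "('v, 'e) mgraph \<Rightarrow> 'e \<Rightarrow> ('v, 'e) mgraph" where
  "contr_edge G e =
     (let u = fst (ends G e); v = snd (ends G e); f = (\<lambda>x. if x = v then u else x) in
      \<lparr>verts = verts G - {v}, edges = edges G - {e},
       ends = (\<lambda>d. (f (fst (ends G d)), f (snd (ends G d))))\<rparr>)"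

definition is_bridge :: "('v, 'e) mgraph \<Rightarrow> 'e \<Rightarrow> bool" where
  "is_bridge G e \<longleftrightarrow> e \<in> edges G \<and>
     \<not> connected_in (del_edge G e) (fst (ends G e)) (snd (ends G e))"

definition has_bridge :: "('v, 'e) mgraph \<Rightarrow> bool" where
  "has_bridge G \<longleftrightarrow> (\<exists>e. is_bridge G e)"

definition restrict_verts :: "('v, 'e) mgraph \<Rightarrow> 'v set \<Rightarrow> ('v, 'e) mgraph" where
  "restrict_verts G W = \<lparr>verts = W,
     edges = {e \<in> edges G. fst (ends G e) \<in> W \<and> snd (ends G e) \<in> W}, ends = ends G\<rparr>"

text \<open>The defining rules of the flow polynomial (on well-formed graphs of a fixed type).
  The disjoint-union rule: if the vertex set splits into W and its complement with
  no edge between them, then G is the disjoint union of the two induced subgraphs.\<close>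
definition flow_rules :: "(('v, 'e) mgraph \<Rightarrow> real poly) \<Rightarrow> bool" where
  "flow_rules \<Phi> \<longleftrightarrow>
     (\<forall>G. wf_mgraph G \<longrightarrow>
        (edges G = {} \<longrightarrow> \<Phi> G = 1) \<and>
        (has_bridge G \<longrightarrow> \<Phi> G = 0) \<and>
        (\<forall>W. W \<subseteq> verts G \<and>
             (\<forall>e\<in>edges G. fst (ends G e) \<in> W \<longleftrightarrow> snd (ends G e) \<in> W) \<longrightarrow>
             \<Phi> G = \<Phi> (restrict_verts G W) * \<Phi> (restrict_verts G (verts G - W))) \<and>
        (\<forall>e\<in>edges G. is_loop G e \<longrightarrow> \<Phi> G = [:-1, 1:] * \<Phi> (del_edge G e)) \<and>
        (\<forall>e\<in>edges G. \<not> has_bridge G \<and> \<not> is_loop G e \<longrightarrow>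
             \<Phi> G = \<Phi> (contr_edge G e) - \<Phi> (del_edge G e)))"

definition flow_poly :: "('v, 'e) mgraph \<Rightarrow> real poly" where
  "flow_poly G = (THE p. \<exists>\<Phi>. flow_rules \<Phi> \<and> \<Phi> G = p)"

definition roots12_count :: "('v, 'e) mgraph \<Rightarrow> nat" where
  "roots12_count G = (\<Sum>x\<in>{x::real. 1 < x \<and> x < 2 \<and> poly (flow_poly G) x = 0}.
                        order x (flow_poly G))"

end

theory Submission
  imports Defs "HOL-Computational_Algebra.Fundamental_Theorem_Algebra"
begin

text \<open>Loops, cuts with at most two edges, and 3-edge cuts with an edge on each side reduce \<open>G\<close>
  to smaller graphs; in the last case \<open>(\<lambda> - 1)(\<lambda> - 2) F(G) = F(G\<^sub>1) F(G\<^sub>2)\<close>, where \<open>G\<^sub>1\<close> and \<open>G\<^sub>2\<close>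
  arise by contracting one side of the cut. In a graph with \<open>n\<close> vertices and \<open>m\<close> edges that admits
  no such reduction every 3-edge cut is a vertex star, so there are \<open>g \<le> n\<close> of them. The expansion
  \<open>F(G, \<lambda>) = \<Sum>A \<subseteq> E. (-1)^|E - A| \<lambda>^(nullity A)\<close> gives the first three coefficients, that is,
  \<open>\<Sum>s = n - 1\<close> and \<open>\<Sum>s\<^sup>2 = 2g - n + 1\<close> for the numbers \<open>s = r - 1\<close>, where \<open>r\<close> runs over the roots.
  The product of the nonzero \<open>s\<close> is a nonzero integer, so by the inequality of arithmetic and
  geometric means their number \<open>q\<close> is at most \<open>\<Sum>s\<^sup>2\<close>. Hence, summing over the nonzero \<open>s\<close>,
  \<open>\<Sum>(s - 1)\<^sup>2 = \<Sum>s\<^sup>2 - 2 \<Sum>s + q \<le> 4 (g - n + 1)\<close>. If \<open>g < n\<close>, this forces \<open>s = 1\<close> for each of them.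
  If \<open>g = n\<close>, then \<open>G\<close> is cubic and the same identity leaves only \<open>n \<in> {2, 4, 6}\<close>.\<close>

section \<open>Connectivity and nullity of edge sets\<close>

definition conn :: "('e \<Rightarrow> 'v \<times> 'v) \<Rightarrow> 'e set \<Rightarrow> 'v \<Rightarrow> 'v \<Rightarrow> bool" where
  "conn en A x y \<longleftrightarrow> (x, y) \<in> {(a, b). \<exists>e\<in>A. en e = (a, b) \<or> en e = (b, a)}\<^sup>*"

lemma conn_refl [simp, intro]: "conn en A x x"
  by (simp add: conn_def)

lemma conn_trans: "conn en A x y \<Longrightarrow> conn en A y z \<Longrightarrow> conn en A x z"
  unfolding conn_def by (rule rtrancl_trans)

lemma conn_sym: assumes "conn en A x y" shows "conn en A y x"
proof -
  have "sym ({(a, b). \<exists>e\<in>A. en e = (a, b) \<or> en e = (b, a)}\<^sup>*)"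
    by (rule sym_rtrancl) (auto simp: sym_def)
  then show ?thesis using assms unfolding conn_def sym_def by blast
qed

lemma conn_commute: "conn en A x y \<longleftrightarrow> conn en A y x"
  using conn_sym by metis

lemma conn_mono: assumes "conn en A x y" "A \<subseteq> B" shows "conn en B x y"
proof -
  have "{(a, b). \<exists>e\<in>A. en e = (a, b) \<or> en e = (b, a)}\<^sup>* \<subseteq> {(a, b). \<exists>e\<in>B. en e = (a, b) \<or> en e = (b, a)}\<^sup>*"
    by (rule rtrancl_mono) (use assms(2) in blast)
  then show ?thesis using assms(1) unfolding conn_def by blast
qed

lemma conn_edge: "e \<in> A \<Longrightarrow> conn en A (fst (en e)) (snd (en e))"
  unfolding conn_def by (rule r_into_rtrancl) (auto intro!: bexI[of _ e])

text \<open>\<open>conn\<close> is the equivalence closure of the end pairs, so every equivalence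
  relation containing them contains it. Symmetry of \<open>R\<close> absorbs the two orientations of
  an edge.\<close>

lemma conn_least:
  assumes "conn en A x y"
    and refl: "\<And>p. R p p" and sym: "\<And>p q. R p q \<Longrightarrow> R q p"
    and trans: "\<And>p q r. R p q \<Longrightarrow> R q r \<Longrightarrow> R p r"
    and edge: "\<And>e. e \<in> A \<Longrightarrow> R (fst (en e)) (snd (en e))"
  shows "R x y"
  using assms(1) unfolding conn_def
proof (induction rule: rtrancl_induct)
  case base show ?case by (rule refl)
next
  case (step p q)
  from step.hyps(2) obtain e where "e \<in> A" "en e = (p, q) \<or> en e = (q, p)" by auto
  then have "R p q" using edge[of e] sym[of q p] by auto
  with step.IH show ?case by (rule trans)
qed

lemma conn_invariant:
  assumes "conn en A x y" "\<And>e. e \<in> A \<Longrightarrow> fst (en e) \<in> X \<longleftrightarrow> snd (en e) \<in> X"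
  shows "x \<in> X \<longleftrightarrow> y \<in> X"
  using assms(1) by (rule conn_least[where R = "\<lambda>p q. p \<in> X \<longleftrightarrow> q \<in> X"]) (use assms(2) in auto)

text \<open>A walk can be shortened so that it uses \<open>e\<close> at most once. Formally, the
  right-hand side is itself an equivalence relation that contains all edges, so
  \<open>conn_least\<close> applies.\<close>

lemma conn_insert:
  "conn en (insert e A) x y \<longleftrightarrow>
    conn en A x y \<or> conn en A x (fst (en e)) \<and> conn en A (snd (en e)) y \<or>
    conn en A x (snd (en e)) \<and> conn en A (fst (en e)) y" (is "_ \<longleftrightarrow> ?R x y")
proof
  assume "conn en (insert e A) x y"
  then show "?R x y"
  proof (rule conn_least)
    show "?R q p" if "?R p q" for p q
      using that by (metis conn_commute)
    show "?R p r" if "?R p q" "?R q r" for p q r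
      using that by (metis conn_commute conn_trans)
    show "?R (fst (en d)) (snd (en d))" if "d \<in> insert e A" for d
      using that conn_edge[of d A en] by auto
  qed auto
next
  have "conn en (insert e A) (fst (en e)) (snd (en e))" by (rule conn_edge) simp
  moreover have "conn en (insert e A) p q" if "conn en A p q" for p q
    using that by (rule conn_mono) auto
  moreover assume "?R x y"
  ultimately show "conn en (insert e A) x y" by (metis conn_commute conn_trans)
qed

lemma conn_insert_redundant:
  assumes "conn en A (fst (en e)) (snd (en e))"
  shows "conn en (insert e A) = conn en A"
  by (intro ext) (metis conn_insert conn_commute conn_trans assms)

definition ends_in :: "('e \<Rightarrow> 'v \<times> 'v) \<Rightarrow> 'e set \<Rightarrow> 'v set \<Rightarrow> bool" where
  "ends_in en A V \<longleftrightarrow> (\<forall>e\<in>A. fst (en e) \<in> V \<and> snd (en e) \<in> V)"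

definition endpoints :: "('e \<Rightarrow> 'v \<times> 'v) \<Rightarrow> 'e set \<Rightarrow> 'v set" where
  "endpoints en A = (\<Union>e\<in>A. {fst (en e), snd (en e)})"

lemma ends_in_endpoints: "ends_in en A (endpoints en A)"
  by (auto simp: ends_in_def endpoints_def)

lemma finite_endpoints: "finite A \<Longrightarrow> finite (endpoints en A)"
  by (auto simp: endpoints_def)

lemma endpoints_subset: "ends_in en A V \<Longrightarrow> endpoints en A \<subseteq> V"
  by (auto simp: ends_in_def endpoints_def)

lemma ends_in_mono: "ends_in en A V \<Longrightarrow> B \<subseteq> A \<Longrightarrow> V \<subseteq> W \<Longrightarrow> ends_in en B W"
  by (auto simp: ends_in_def)

lemma conn_outside:
  assumes "ends_in en A V" "x \<notin> V"
  shows "conn en A x y \<longleftrightarrow> x = y"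
proof -
  have "x = y" if "conn en A x y"
    using conn_invariant[OF that, of "{x}"] assms by (auto simp: ends_in_def)
  then show ?thesis by auto
qed

lemma Collect_conn_eq_iff: "Collect (conn en A x) = Collect (conn en A y) \<longleftrightarrow> conn en A x y"
proof
  assume "Collect (conn en A x) = Collect (conn en A y)"
  moreover have "y \<in> Collect (conn en A y)" by simp
  ultimately show "conn en A x y" by blast
next
  assume "conn en A x y"
  then show "Collect (conn en A x) = Collect (conn en A y)"
    by (auto intro: conn_trans conn_sym)
qed

section \<open>Counting components, and nullity under the addition of an edge\<close>

definition ncomp :: "('e \<Rightarrow> 'v \<times> 'v) \<Rightarrow> 'v set \<Rightarrow> 'e set \<Rightarrow> nat" where
  "ncomp en V A = card ((\<lambda>x. Collect (conn en A x)) ` V)"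

lemma ncomp_empty: "finite V \<Longrightarrow> ncomp en V {} = card V"
proof -
  have "inj_on (\<lambda>x. Collect (conn en {} x)) V"
  proof (rule inj_onI)
    fix x y assume "Collect (conn en {} x) = Collect (conn en {} y)"
    then have "conn en {} x y" by (simp add: Collect_conn_eq_iff)
    then show "x = y" by (simp add: conn_def)
  qed
  then show ?thesis unfolding ncomp_def by (rule card_image)
qed

lemma ncomp_insert_vertex:
  assumes "finite V" "ends_in en A V" "x \<notin> V"
  shows "ncomp en (insert x V) A = Suc (ncomp en V A)"
proof -
  have "Collect (conn en A x) \<notin> (\<lambda>x. Collect (conn en A x)) ` V"
  proof
    assume "Collect (conn en A x) \<in> (\<lambda>x. Collect (conn en A x)) ` V"
    then obtain y where "y \<in> V" "Collect (conn en A x) = Collect (conn en A y)" by auto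
    then show False using conn_outside[OF assms(2,3)] assms(3) by (auto simp: Collect_conn_eq_iff)
  qed
  then show ?thesis using assms(1) unfolding ncomp_def by simp
qed

lemma card_image_cong_kernel:
  assumes "\<And>x y. x \<in> W \<Longrightarrow> y \<in> W \<Longrightarrow> f x = f y \<longleftrightarrow> g x = g y"
  shows "card (f ` W) = card (g ` W)"
proof -
  let ?h = "\<lambda>c. g (inv_into W f c)"
  have h: "?h (f x) = g x" if "x \<in> W" for x
    using assms[of "inv_into W f (f x)" x] that by (simp add: inv_into_into f_inv_into_f)
  have "inj_on ?h (f ` W)" by (rule inj_onI) (auto simp: h assms)
  moreover have "?h ` f ` W = g ` W" by (simp add: image_image h)
  ultimately show ?thesis by (metis card_image)
qed

lemma ncomp_insert_edge:
  assumes V: "finite V" "fst (en e) \<in> V" "snd (en e) \<in> V"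
  shows "ncomp en V A = ncomp en V (insert e A) + (if conn en A (fst (en e)) (snd (en e)) then 0 else 1)"
proof (cases "conn en A (fst (en e)) (snd (en e))")
  case True
  then show ?thesis by (simp add: ncomp_def conn_insert_redundant)
next
  case False
  define u v where "u = fst (en e)" and "v = snd (en e)"
  have uv: "u \<in> V" "v \<in> V" "\<not> conn en A u v" using V False by (auto simp: u_def v_def)
  let ?C = "\<lambda>x. Collect (conn en A x)" and ?D = "\<lambda>x. Collect (conn en (insert e A) x)"
  \<comment> \<open>\<open>W\<close> drops the old class of \<open>v\<close>. Once \<open>e\<close>
    is added, that class merges with the class of \<open>u\<close>, which is still represented in
    \<open>W\<close>. On \<open>W\<close> old and new connectivity agree, so the old count exceeds
    the new one by exactly the class of \<open>v\<close>.\<close>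
  define W where "W = {x \<in> V. \<not> conn en A v x}"
  have ins: "conn en (insert e A) x y \<longleftrightarrow> conn en A x y \<or> conn en A x u \<and> conn en A v y \<or> conn en A x v \<and> conn en A u y" for x y
    unfolding u_def v_def by (rule conn_insert)
  have "?D x \<in> ?D ` W" if "x \<in> V" for x
  proof (cases "conn en A v x")
    case True
    then have "conn en (insert e A) x u" by (metis ins conn_commute conn_refl)
    moreover have "u \<in> W" using uv by (auto simp: W_def conn_commute)
    ultimately show ?thesis by (metis Collect_conn_eq_iff imageI)
  next
    case False
    then show ?thesis using that by (auto simp: W_def)
  qed
  then have "?D ` V = ?D ` W" by (auto simp: W_def)
  moreover have "card (?D ` W) = card (?C ` W)"
  proof (rule card_image_cong_kernel)
    show "?D x = ?D y \<longleftrightarrow> ?C x = ?C y" if "x \<in> W" "y \<in> W" for x y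
      using that unfolding Collect_conn_eq_iff W_def ins
      by (metis (mono_tags, lifting) conn_commute mem_Collect_eq)
  qed
  moreover have "?C ` V = insert (?C v) (?C ` W)"
  proof (intro equalityI subsetI)
    fix c assume "c \<in> ?C ` V"
    then obtain x where "x \<in> V" "c = ?C x" by blast
    then show "c \<in> insert (?C v) (?C ` W)"
      using Collect_conn_eq_iff[of en A v x] by (cases "conn en A v x") (auto simp: W_def)
  qed (use uv in \<open>auto simp: W_def\<close>)
  moreover have "?C v \<notin> ?C ` W"
    by (auto simp: W_def Collect_conn_eq_iff image_iff)
  moreover have "finite W" using V(1) by (simp add: W_def)
  ultimately show ?thesis using False unfolding ncomp_def by simp
qed

text \<open>The subtraction never truncates, by \<open>card_le_edges_comps\<close>.\<close>

definition nullity :: "('e \<Rightarrow> 'v \<times> 'v) \<Rightarrow> 'e set \<Rightarrow> nat" where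
  "nullity en A = card A + ncomp en (endpoints en A) A - card (endpoints en A)"

lemma card_le_edges_comps:
  assumes "finite A" "finite V" "ends_in en A V"
  shows "card V \<le> card A + ncomp en V A"
  using assms(1,3)
proof (induction A)
  case empty
  then show ?case using ncomp_empty[OF assms(2), of en] by simp
next
  case (insert e A)
  have "ends_in en A V" "fst (en e) \<in> V" "snd (en e) \<in> V"
    using insert.prems by (auto simp: ends_in_def)
  then show ?case using insert ncomp_insert_edge[of V en e A] assms(2) by (auto split: if_splits)
qed

text \<open>An additional isolated vertex raises the number of vertices and the number of components
  by one each. Hence the endpoints in the definition of \<open>nullity\<close> may be replaced by
  any finite vertex set containing them.\<close>

lemma nullity_vertices:
  assumes "finite A" "finite V" "ends_in en A V"
  shows "nullity en A + card V = card A + ncomp en V A"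
proof -
  have ext: "card V' + ncomp en (endpoints en A) A = ncomp en V' A + card (endpoints en A)"
    if "finite V'" "endpoints en A \<subseteq> V'" for V'
    using that
  proof (induction "V' - endpoints en A" arbitrary: V' rule: infinite_finite_induct)
    case infinite then show ?case by simp
  next
    case empty then have "V' = endpoints en A" by blast
    then show ?case by simp
  next
    case (insert x F)
    have x: "x \<in> V'" "x \<notin> endpoints en A" "F = (V' - {x}) - endpoints en A" using insert.hyps by auto
    have "card (V' - {x}) + ncomp en (endpoints en A) A = ncomp en (V' - {x}) A + card (endpoints en A)"
      by (rule insert.hyps(3)) (use x insert.prems in auto)
    moreover have "ncomp en (insert x (V' - {x})) A = Suc (ncomp en (V' - {x}) A)"
      by (rule ncomp_insert_vertex)
        (use x insert.prems ends_in_endpoints[of en A] in \<open>auto intro: ends_in_mono\<close>)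
    moreover have "card V' = Suc (card (V' - {x}))"
      using x(1) insert.prems(1) by (metis card_Suc_Diff1)
    moreover have "insert x (V' - {x}) = V'" using x(1) by blast
    ultimately show ?case by simp
  qed
  show ?thesis
    using ext[OF assms(2) endpoints_subset[OF assms(3)]]
      card_le_edges_comps[OF assms(1) finite_endpoints[OF assms(1)] ends_in_endpoints[of en]]
    by (simp add: nullity_def)
qed

lemma nullity_empty [simp]: "nullity en {} = 0"
  by (simp add: nullity_def endpoints_def ncomp_def)

text \<open>Nullity is the dimension of the cycle space: a new edge closes a cycle exactly when its
  ends are already connected. Later inductions on edge sets rest on this recursion.\<close>

lemma nullity_insert:
  assumes "finite A" "e \<notin> A"
  shows "nullity en (insert e A) = nullity en A + (if conn en A (fst (en e)) (snd (en e)) then 1 else 0)"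
proof -
  let ?V = "endpoints en (insert e A)"
  have V: "finite ?V" "ends_in en (insert e A) ?V" "ends_in en A ?V" "fst (en e) \<in> ?V" "snd (en e) \<in> ?V"
    using assms(1) by (auto simp: ends_in_def endpoints_def)
  show ?thesis
    using nullity_vertices[OF assms(1) V(1,3)] nullity_vertices[OF _ V(1,2)]
      ncomp_insert_edge[of ?V en e A] V(1,4,5) assms by (auto split: if_splits)
qed

lemma nullity_mono:
  assumes "finite B" "A \<subseteq> B" shows "nullity en A \<le> nullity en B"
proof -
  have "nullity en A \<le> nullity en (A \<union> C)" if "finite C" "finite A" for C
    using that
  proof (induction C)
    case (insert c C)
    then show ?case
      by (cases "c \<in> A") (auto simp: insert_absorb nullity_insert)
  qed auto
  from this[of B] assms show ?thesis by (auto dest: finite_subset simp: Un_absorb1)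
qed

lemma nullity_cong:
  assumes "finite A" "\<And>e. e \<in> A \<Longrightarrow> en e = en' e"
  shows "nullity en A = nullity en' A"
  using assms
proof (induction A)
  case (insert e A)
  have "conn en A = conn en' A"
    unfolding conn_def using insert.prems by (intro ext) auto
  then show ?case using insert by (auto simp: nullity_insert)
qed simp

section \<open>Contraction and relabelling of vertices\<close>

definition map_ends :: "('v \<Rightarrow> 'w) \<Rightarrow> ('e \<Rightarrow> 'v \<times> 'v) \<Rightarrow> 'e \<Rightarrow> 'w \<times> 'w" where
  "map_ends f en e = (f (fst (en e)), f (snd (en e)))"

lemma fst_map_ends [simp]: "fst (map_ends f en e) = f (fst (en e))"
  and snd_map_ends [simp]: "snd (map_ends f en e) = f (snd (en e))"
  by (auto simp: map_ends_def)

text \<open>The assumptions say that \<open>f\<close> contracts \<open>C\<close>: it collapses the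
  edges of \<open>C\<close>, and the points of \<open>U\<close> that it identifies are joined by
  \<open>C\<close>.\<close>

lemma conn_map:
  assumes ker: "\<And>p q. p \<in> U \<Longrightarrow> q \<in> U \<Longrightarrow> f p = f q \<Longrightarrow> conn en C p q"
    and C: "\<And>e. e \<in> C \<Longrightarrow> f (fst (en e)) = f (snd (en e))"
    and U: "ends_in en A U" "x \<in> U" "y \<in> U"
  shows "conn (map_ends f en) A (f x) (f y) \<longleftrightarrow> conn en (A \<union> C) x y"
proof
  let ?R = "\<lambda>p q. p = q \<or> (p \<in> f ` U \<and> q \<in> f ` U \<and>
    (\<forall>x\<in>U. \<forall>y\<in>U. f x = p \<longrightarrow> f y = q \<longrightarrow> conn en (A \<union> C) x y))"
  have ker': "conn en (A \<union> C) p q" if "p \<in> U" "q \<in> U" "f p = f q" for p q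
    using ker[OF that] by (rule conn_mono) auto
  assume "conn (map_ends f en) A (f x) (f y)"
  then have "?R (f x) (f y)"
  proof (rule conn_least)
    show "?R q p" if "?R p q" for p q using that by (metis conn_commute)
    show "?R p r" if "?R p q" "?R q r" for p q r
      using that by (smt (verit) conn_trans imageE)
    fix e assume "e \<in> A"
    have "conn en (A \<union> C) (fst (en e)) (snd (en e))" by (rule conn_edge) (use \<open>e \<in> A\<close> in auto)
    moreover have "fst (en e) \<in> U" "snd (en e) \<in> U" using U(1) \<open>e \<in> A\<close> by (auto simp: ends_in_def)
    ultimately have "conn en (A \<union> C) p q"
      if "p \<in> U" "q \<in> U" "f p = f (fst (en e))" "f q = f (snd (en e))" for p q
      using that ker'[of p "fst (en e)"] ker'[of "snd (en e)" q] by (metis conn_trans)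
    with \<open>fst (en e) \<in> U\<close> \<open>snd (en e) \<in> U\<close>
    show "?R (fst (map_ends f en e)) (snd (map_ends f en e))" by auto
  qed auto
  then show "conn en (A \<union> C) x y" using U ker' by blast
next
  assume "conn en (A \<union> C) x y"
  then show "conn (map_ends f en) A (f x) (f y)"
  proof (rule conn_least[where R = "\<lambda>p q. conn (map_ends f en) A (f p) (f q)"])
    fix e assume "e \<in> A \<union> C"
    then show "conn (map_ends f en) A (f (fst (en e))) (f (snd (en e)))"
      using conn_edge[of e A "map_ends f en"] C[of e] by auto
  qed (auto intro: conn_sym conn_trans)
qed

text \<open>Contracting a forest \<open>C\<close> preserves nullity, since by
  \<open>conn_map\<close> each edge of \<open>A\<close> closes a cycle in the contraction exactly
  when it does so in the presence of \<open>C\<close>. The case of empty \<open>C\<close> handles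
  injective relabelling.\<close>

lemma nullity_map:
  assumes "finite A" "finite C" "A \<inter> C = {}" "nullity en C = 0" "ends_in en A U"
    and ker: "\<And>p q. p \<in> U \<Longrightarrow> q \<in> U \<Longrightarrow> f p = f q \<Longrightarrow> conn en C p q"
    and C: "\<And>e. e \<in> C \<Longrightarrow> f (fst (en e)) = f (snd (en e))"
  shows "nullity (map_ends f en) A = nullity en (A \<union> C)"
  using assms(1,3,5)
proof (induction A)
  case (insert e A)
  have U: "ends_in en A U" "fst (en e) \<in> U" "snd (en e) \<in> U" 
    using insert.prems by (auto simp: ends_in_def)
  have "conn (map_ends f en) A (f (fst (en e))) (f (snd (en e))) \<longleftrightarrow> conn en (A \<union> C) (fst (en e)) (snd (en e))"
    by (rule conn_map[OF ker C U]) auto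
  moreover have "e \<notin> A \<union> C" using insert by auto
  ultimately show ?case using insert U \<open>finite C\<close> by (simp add: nullity_insert)
qed (use assms in auto)

section \<open>The subgraph expansion of the flow polynomial\<close>

text \<open>In an abelian group of order \<open>x\<close> the flows supported in \<open>A\<close>
  number \<open>x ^ nullity en A\<close>, and inclusion-exclusion leaves the nowhere-zero ones. The
  argument ranges over any commutative ring, so one sum serves as a polynomial at
  \<open>[:0, 1:]\<close> and as a value at a number.\<close>

definition flow_sum :: "('e \<Rightarrow> 'v \<times> 'v) \<Rightarrow> 'e set \<Rightarrow> 'a::comm_ring_1 \<Rightarrow> 'a" where
  "flow_sum en E x = (\<Sum>A\<in>Pow E. (- 1) ^ card (E - A) * x ^ nullity en A)"

lemma flow_sum_empty [simp]: "flow_sum en {} x = 1"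
  by (simp add: flow_sum_def)

text \<open>Each \<open>A\<close> is paired with \<open>insert e A\<close>, which has the opposite
  sign. The loop, bridge and contraction rules follow by comparing the two nullities in a
  pair.\<close>

lemma flow_sum_insert:
  assumes "finite E" "e \<notin> E"
  shows "flow_sum en (insert e E) x =
    (\<Sum>A\<in>Pow E. (- 1) ^ card (E - A) * (x ^ nullity en (insert e A) - x ^ nullity en A))"
proof -
  let ?t = "\<lambda>A. (- 1) ^ card (insert e E - A) * x ^ nullity en A"
  have "flow_sum en (insert e E) x = sum ?t (Pow E) + sum ?t (insert e ` Pow E)"
    unfolding flow_sum_def Pow_insert by (rule sum.union_disjoint) (use assms in auto)
  also have "sum ?t (insert e ` Pow E) = (\<Sum>A\<in>Pow E. ?t (insert e A))"
    by (rule sum.reindex_cong[where l = "insert e"])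
      (use assms in \<open>auto intro!: inj_onI dest: insert_ident[THEN iffD1, rotated 2]\<close>)
  also have "\<dots> = (\<Sum>A\<in>Pow E. (- 1) ^ card (E - A) * x ^ nullity en (insert e A))"
    using assms by (intro sum.cong refl) (simp add: Diff_insert[symmetric] insert_Diff_if Diff_insert0)
  also have "sum ?t (Pow E) = (\<Sum>A\<in>Pow E. - ((- 1) ^ card (E - A) * x ^ nullity en A))"
  proof (intro sum.cong refl)
    fix A assume "A \<in> Pow E"
    then have "insert e E - A = insert e (E - A)" "e \<notin> E - A" "finite (E - A)" using assms by auto
    then show "?t A = - ((- 1) ^ card (E - A) * x ^ nullity en A)" by simp
  qed
  finally show ?thesis by (simp add: sum.distrib[symmetric] algebra_simps)
qed

lemma flow_sum_cong:
  assumes "finite E" "\<And>e. e \<in> E \<Longrightarrow> en e = en' e"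
  shows "flow_sum en E x = flow_sum en' E x"
  unfolding flow_sum_def
proof (intro sum.cong refl)
  fix A assume "A \<in> Pow E"
  then have "nullity en A = nullity en' A"
    using assms by (intro nullity_cong) (auto dest: finite_subset)
  then show "(- 1) ^ card (E - A) * x ^ nullity en A = (- 1) ^ card (E - A) * x ^ nullity en' A" by simp
qed

lemma flow_sum_loop:
  assumes "finite E" "e \<notin> E" "fst (en e) = snd (en e)"
  shows "flow_sum en (insert e E) x = (x - 1) * flow_sum en E x"
proof -
  have "nullity en (insert e A) = Suc (nullity en A)" if "A \<in> Pow E" for A
    using that assms by (subst nullity_insert) (auto dest: finite_subset)
  then show ?thesis
    unfolding flow_sum_insert[OF assms(1,2)] unfolding flow_sum_def sum_distrib_left
    by (intro sum.cong refl) (simp add: algebra_simps)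
qed

lemma flow_sum_bridge:
  assumes "finite E" "e \<notin> E" "\<not> conn en E (fst (en e)) (snd (en e))"
  shows "flow_sum en (insert e E) x = 0"
proof -
  have "nullity en (insert e A) = nullity en A" if "A \<in> Pow E" for A
    using that assms conn_mono[of en A "fst (en e)" "snd (en e)" E]
    by (subst nullity_insert) (auto dest: finite_subset)
  then show ?thesis unfolding flow_sum_insert[OF assms(1,2)] by simp
qed

lemma flow_sum_cut_edge:
  assumes "finite E" "e \<in> E" "fst (en e) \<in> Y \<longleftrightarrow> snd (en e) \<notin> Y"
    and "\<And>d. d \<in> E \<Longrightarrow> d \<noteq> e \<Longrightarrow> fst (en d) \<in> Y \<longleftrightarrow> snd (en d) \<in> Y"
  shows "flow_sum en E x = 0"
proof -
  have "\<not> conn en (E - {e}) (fst (en e)) (snd (en e))"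
    using conn_invariant[of en "E - {e}" "fst (en e)" "snd (en e)" Y] assms by auto
  then have "flow_sum en (insert e (E - {e})) x = 0"
    by (rule flow_sum_bridge[rotated 2]) (use assms in auto)
  then show ?thesis using assms(2) by (simp add: insert_absorb)
qed

text \<open>For an edge, \<open>X\<close> consists of its second end and \<open>a\<close> is its
  first end, as in \<open>contr_edge\<close>. The same map contracts a whole side of a cut.\<close>

definition shrink :: "'v set \<Rightarrow> 'v \<Rightarrow> 'v \<Rightarrow> 'v" where
  "shrink X a z = (if z \<in> X then a else z)"

lemma flow_sum_contract:
  assumes "finite E" "e \<notin> E" "fst (en e) \<noteq> snd (en e)"
  shows "flow_sum en (insert e E) x =
    flow_sum (map_ends (shrink {snd (en e)} (fst (en e))) en) E x - flow_sum en E x"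
proof -
  let ?f = "shrink {snd (en e)} (fst (en e))"
  have e: "conn en {e} (fst (en e)) (snd (en e))" by (rule conn_edge) simp
  have "nullity (map_ends ?f en) A = nullity en (insert e A)" if "A \<in> Pow E" for A
  proof -
    have "nullity (map_ends ?f en) A = nullity en (A \<union> {e})"
    proof (rule nullity_map[where U = UNIV])
      show "nullity en {e} = 0"
        using assms(3) nullity_insert[of "{}" e en] by (auto simp: conn_def)
      show "conn en {e} p q" if "?f p = ?f q" for p q
        using that e by (auto simp: shrink_def conn_commute split: if_splits)
    qed (use that assms in \<open>auto simp: ends_in_def shrink_def dest: finite_subset\<close>)
    then show ?thesis by simp
  qed
  then have "flow_sum (map_ends ?f en) E x = (\<Sum>A\<in>Pow E. (- 1) ^ card (E - A) * x ^ nullity en (insert e A))"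
    unfolding flow_sum_def by (intro sum.cong refl) simp
  then show ?thesis
    unfolding flow_sum_insert[OF assms(1,2)] by (simp add: flow_sum_def right_diff_distrib sum_subtractf)
qed

lemma flow_sum_inj:
  assumes "finite E" "ends_in en E U" "inj_on f U"
  shows "flow_sum (map_ends f en) E x = flow_sum en E x"
  unfolding flow_sum_def
proof (intro sum.cong refl)
  fix A assume "A \<in> Pow E"
  have "nullity (map_ends f en) A = nullity en (A \<union> {})"
  proof (rule nullity_map[where U = U])
    show "conn en {} p q" if "p \<in> U" "q \<in> U" "f p = f q" for p q
      using that assms(3) by (auto dest: inj_onD)
  qed (use \<open>A \<in> Pow E\<close> assms in \<open>auto simp: ends_in_def dest: finite_subset\<close>)
  then show "(- 1) ^ card (E - A) * x ^ nullity (map_ends f en) A = (- 1) ^ card (E - A) * x ^ nullity en A"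
    by simp
qed

text \<open>All powers of 1 agree, so the pairs in \<open>flow_sum_insert\<close> cancel. This
  supplies the root 1.\<close>

lemma flow_sum_one:
  assumes "finite E" "E \<noteq> {}" shows "flow_sum en E 1 = 0"
proof -
  from assms obtain e where "e \<in> E" by auto
  then have "flow_sum en (insert e (E - {e})) 1 = 0"
    using assms by (subst flow_sum_insert) auto
  then show ?thesis using \<open>e \<in> E\<close> by (simp add: insert_absorb)
qed

lemma flow_sum_loops:
  assumes "finite S" "\<And>e. e \<in> S \<Longrightarrow> fst (en e) = snd (en e)"
  shows "flow_sum en S x = (x - 1) ^ card S"
  using assms by (induction S) (auto simp: flow_sum_loop)

lemma flow_sum_triple_edge:
  assumes "card S = 3" "a \<noteq> b" "\<And>e. e \<in> S \<Longrightarrow> en e = (a, b) \<or> en e = (b, a)"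
  shows "flow_sum en S x = (x - 1) * (x - 2)"
proof -
  \<comment> \<open>Contracting one of several parallel edges turns the remaining ones into loops,
    each contributing a factor \<open>x - 1\<close>.\<close>
  have step: "flow_sum en (insert e T) x = (x - 1) ^ card T - flow_sum en T x"
    if "e \<notin> T" "insert e T \<subseteq> S" for e T
  proof -
    have "finite T" using that assms(1) by (metis card.infinite finite_insert finite_subset zero_neq_numeral)
    moreover have "flow_sum (map_ends (shrink {snd (en e)} (fst (en e))) en) T x = (x - 1) ^ card T"
    proof (rule flow_sum_loops[OF \<open>finite T\<close>])
      fix d assume "d \<in> T"
      then have "d \<in> S" "e \<in> S" using that by auto
      then show "fst (map_ends (shrink {snd (en e)} (fst (en e))) en d) = snd (map_ends (shrink {snd (en e)} (fst (en e))) en d)"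
        using assms(3)[OF \<open>e \<in> S\<close>] assms(3)[OF \<open>d \<in> S\<close>] by (auto simp: shrink_def)
    qed
    ultimately show ?thesis
      using that assms(2) assms(3)[of e] by (subst flow_sum_contract) auto
  qed
  obtain e1 e2 e3 where S: "S = {e1, e2, e3}" "e1 \<noteq> e2" "e1 \<noteq> e3" "e2 \<noteq> e3"
    using assms(1) by (auto simp: card_3_iff)
  have "flow_sum en S x = (x - 1) ^ 2 - ((x - 1) - (1 - 1))"
    using S step[of e1 "{e2, e3}"] step[of e2 "{e3}"] step[of e3 "{}"]
    by (simp add: card_insert_if power2_eq_square)
  then show ?thesis by (simp add: algebra_simps power2_eq_square)
qed

section \<open>Factorization along cuts with at most three edges\<close>

definition crossing :: "('e \<Rightarrow> 'v \<times> 'v) \<Rightarrow> 'v set \<Rightarrow> 'e \<Rightarrow> bool" where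
  "crossing en X e \<longleftrightarrow> (fst (en e) \<in> X \<longleftrightarrow> snd (en e) \<notin> X)"

text \<open>If every value were taken twice, two values would need four elements. This is where the
  bound of three cut edges enters \<open>flow_sum_cut\<close>.\<close>

lemma exists_unique_value:
  assumes "finite S" "card S \<le> 3" "e1 \<in> S" "e2 \<in> S" "f e1 \<noteq> f e2"
  shows "\<exists>e\<in>S. \<forall>d\<in>S. f d = f e \<longrightarrow> d = e"
proof (rule ccontr)
  assume "\<not> ?thesis"
  then obtain d1 d2 where d: "d1 \<in> S" "f d1 = f e1" "d1 \<noteq> e1" "d2 \<in> S" "f d2 = f e2" "d2 \<noteq> e2"
    using assms(3,4) by metis
  then have "card {e1, d1, e2, d2} = 4" using assms(5) by (auto simp: card_insert_if)
  moreover have "card {e1, d1, e2, d2} \<le> card S" using d assms by (intro card_mono) auto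
  ultimately show False using assms(2) by simp
qed

text \<open>The factor for a cut with \<open>k\<close> edges is the flow polynomial of \<open>k\<close> parallel edges.
  For \<open>k \<le> 3\<close> the identity holds because, once one side has no inner edges, either all
  cut edges meet in one vertex there or some cut edge is a bridge.\<close>

theorem flow_sum_cut:
  assumes "finite EA" "finite S" "finite EB" "card S \<le> 3"
    and "EA \<inter> S = {}" "EA \<inter> EB = {}" "S \<inter> EB = {}"
    and "ends_in en EA X" "ends_in en EB (- X)" "\<And>e. e \<in> S \<Longrightarrow> crossing en X e"
    and ab: "a \<in> X" "b \<notin> X"
  shows "flow_sum (map_ends (shrink X a) (map_ends (shrink (- X) b) en)) S x * flow_sum en (EA \<union> S \<union> EB) x
    = flow_sum (map_ends (shrink X a) en) (S \<union> EB) x * flow_sum (map_ends (shrink (- X) b) en) (EA \<union> S) x"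
  using assms(3,6,7,8,9,10)
proof (induction "card EB" arbitrary: EB en)
  case 0
  then have EB: "EB = {}" by simp
  \<comment> \<open>The two contractions commute because each target vertex lies on its own side and
    is not moved by the other contraction.\<close>
  have comm: "map_ends (shrink X a) (map_ends (shrink (- X) b) en) = map_ends (shrink (- X) b) (map_ends (shrink X a) en)"
    using ab by (auto simp: map_ends_def shrink_def)
  define tip where "tip e = (if fst (en e) \<in> X then snd (en e) else fst (en e))" for e
  have tip: "tip e \<notin> X \<and> ((fst (en e) \<in> X \<and> snd (en e) = tip e) \<or> (fst (en e) = tip e \<and> snd (en e) \<in> X))"
    if "e \<in> S" for e
    using 0(7)[OF that] by (auto simp: tip_def crossing_def)
  show ?case
  proof (cases "\<exists>y. y \<notin> X \<and> (\<forall>e\<in>S. tip e = y)")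
    case True
    then obtain y where y: "y \<notin> X" "\<And>e. e \<in> S \<Longrightarrow> tip e = y" by auto
    \<comment> \<open>All cut edges meet in \<open>y\<close>, so on the vertices in use shrinking
      the complement of \<open>X\<close> only renames \<open>y\<close> to \<open>b\<close>. The two
      factors are then the same on both sides of the identity.\<close>
    have inj: "inj_on (shrink (- X) b) (insert y X)"
      using y(1) ab by (auto simp: inj_on_def shrink_def)
    have "flow_sum (map_ends (shrink (- X) b) en) (EA \<union> S) x = flow_sum en (EA \<union> S) x"
      by (rule flow_sum_inj[OF _ _ inj]) (use assms(1,2) 0(5) tip y in \<open>auto simp: ends_in_def\<close>)
    moreover have "flow_sum (map_ends (shrink (- X) b) (map_ends (shrink X a) en)) S x = flow_sum (map_ends (shrink X a) en) S x"
      by (rule flow_sum_inj[OF _ _ inj]) (use assms(2) tip y ab in \<open>fastforce simp: ends_in_def shrink_def\<close>)+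
    ultimately show ?thesis by (simp add: EB comm)
  next
    case False
    then obtain e1 e2 where "e1 \<in> S" "e2 \<in> S" "tip e1 \<noteq> tip e2" using tip ab by metis
    from exists_unique_value[where f = tip, OF assms(2,4) this]
    obtain e where e: "e \<in> S" "\<And>d. d \<in> S \<Longrightarrow> tip d = tip e \<Longrightarrow> d = e" by metis
    \<comment> \<open>\<open>e\<close> is the only edge at the vertex \<open>tip e\<close>, hence a
      bridge. It remains a bridge after \<open>X\<close> is shrunk, so both sides of the identity
      vanish.\<close>
    have "flow_sum en (EA \<union> S) x = 0"
    proof (rule flow_sum_cut_edge[where e = e and Y = "{tip e}"])
      show "fst (en e) \<in> {tip e} \<longleftrightarrow> snd (en e) \<notin> {tip e}" using tip[OF e(1)] by auto
      fix d assume "d \<in> EA \<union> S" "d \<noteq> e"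
      then show "fst (en d) \<in> {tip e} \<longleftrightarrow> snd (en d) \<in> {tip e}"
        using tip[OF e(1)] tip[of d] e(2)[of d] 0(5) by (auto simp: ends_in_def)
    qed (use assms e in auto)
    moreover have "flow_sum (map_ends (shrink X a) en) S x = 0"
    proof (rule flow_sum_cut_edge[where e = e and Y = "{tip e}"])
      show "fst (map_ends (shrink X a) en e) \<in> {tip e} \<longleftrightarrow> snd (map_ends (shrink X a) en e) \<notin> {tip e}"
        using tip[OF e(1)] ab by (auto simp: shrink_def)
      fix d assume "d \<in> S" "d \<noteq> e"
      then show "fst (map_ends (shrink X a) en d) \<in> {tip e} \<longleftrightarrow> snd (map_ends (shrink X a) en d) \<in> {tip e}"
        using tip[OF e(1)] tip[of d] e(2)[of d] ab by (auto simp: shrink_def)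
    qed (use assms e in auto)
    ultimately show ?thesis by (simp add: EB)
  qed
next
  case (Suc n)
  then obtain e EB' where EB: "EB = insert e EB'" "e \<notin> EB'" "n = card EB'"
    by (metis card_Suc_eq)
  have fin: "finite (EA \<union> S \<union> EB')" "finite (S \<union> EB')" and notin: "e \<notin> EA \<union> S \<union> EB'" "e \<notin> S \<union> EB'"
    using assms(1,2) Suc.prems EB by auto
  have un: "EA \<union> S \<union> EB = insert e (EA \<union> S \<union> EB')" "S \<union> EB = insert e (S \<union> EB')" using EB by auto
  have e: "fst (en e) \<notin> X" "snd (en e) \<notin> X" using Suc.prems(5) EB by (auto simp: ends_in_def)
  have IH: "flow_sum (map_ends (shrink X a) (map_ends (shrink (- X) b) en)) S x * flow_sum en (EA \<union> S \<union> EB') x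
    = flow_sum (map_ends (shrink X a) en) (S \<union> EB') x * flow_sum (map_ends (shrink (- X) b) en) (EA \<union> S) x"
    by (rule Suc.hyps(1)) (use Suc.prems EB in \<open>auto simp: ends_in_def\<close>)
  show ?case
  proof (cases "fst (en e) = snd (en e)")
    case True
    then show ?thesis unfolding un
      using IH flow_sum_loop[OF fin(1) notin(1), of en x] True
        flow_sum_loop[OF fin(2) notin(2), of "map_ends (shrink X a) en" x]
      by (simp add: mult.left_commute mult.assoc)
  next
    case False
    let ?f = "shrink {snd (en e)} (fst (en e))"
    \<comment> \<open>Contracting \<open>e\<close> takes place outside \<open>X\<close>: it has no
      effect once the complement of \<open>X\<close> is shrunk to \<open>b\<close>, and it commutes
      with shrinking \<open>X\<close> to \<open>a\<close>. Both sides therefore satisfy the same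
      deletion-contraction recurrence in \<open>e\<close>.\<close>
    let ?en = "map_ends ?f en"
    have f: "?f z \<in> X \<longleftrightarrow> z \<in> X" for z using e by (auto simp: shrink_def)
    have "flow_sum (map_ends (shrink X a) (map_ends (shrink (- X) b) ?en)) S x * flow_sum ?en (EA \<union> S \<union> EB') x
      = flow_sum (map_ends (shrink X a) ?en) (S \<union> EB') x * flow_sum (map_ends (shrink (- X) b) ?en) (EA \<union> S) x"
      by (rule Suc.hyps(1)) (use Suc.prems EB f in \<open>auto simp: ends_in_def crossing_def\<close>)
    moreover have "map_ends (shrink (- X) b) ?en = map_ends (shrink (- X) b) en"
      using e by (auto simp: map_ends_def shrink_def)
    moreover have "map_ends (shrink X a) ?en = map_ends ?f (map_ends (shrink X a) en)"
      using e ab by (auto simp: map_ends_def shrink_def fun_eq_iff)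
    moreover have "flow_sum (map_ends (shrink X a) en) (insert e (S \<union> EB')) x =
      flow_sum (map_ends ?f (map_ends (shrink X a) en)) (S \<union> EB') x - flow_sum (map_ends (shrink X a) en) (S \<union> EB') x"
      using flow_sum_contract[OF fin(2) notin(2), of "map_ends (shrink X a) en" x] e False by (simp add: shrink_def[of X])
    moreover have "flow_sum en (insert e (EA \<union> S \<union> EB')) x = flow_sum ?en (EA \<union> S \<union> EB') x - flow_sum en (EA \<union> S \<union> EB') x"
      by (rule flow_sum_contract) (use fin notin False in auto)
    ultimately show ?thesis unfolding un using IH by (simp only: left_diff_distrib right_diff_distrib)
  qed
qed

text \<open>This is \<open>flow_sum_cut\<close> for the empty cut. Shrinking one side does not move
  the ends of edges on the other.\<close>

lemma flow_sum_disjoint: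
  assumes fin: "finite E1" "finite E2" and E: "ends_in en E1 X" "ends_in en E2 (- X)"
  shows "flow_sum en (E1 \<union> E2) x = flow_sum en E1 x * flow_sum en E2 x"
proof (cases "E1 = {} \<or> E2 = {}")
  case False
  then obtain e1 e2 where "e1 \<in> E1" "e2 \<in> E2" by auto
  then have ab: "fst (en e1) \<in> X" "fst (en e2) \<notin> X" using E by (auto simp: ends_in_def)
  have "flow_sum en (E1 \<union> E2) x = flow_sum (map_ends (shrink X (fst (en e1))) en) E2 x *
      flow_sum (map_ends (shrink (- X) (fst (en e2))) en) E1 x"
    using flow_sum_cut[of E1 "{}" E2 en X _ _ x, OF fin(1) _ fin(2) _ _ _ _ E _ ab] E
    by (auto simp: ends_in_def)
  also have "flow_sum (map_ends (shrink X (fst (en e1))) en) E2 x = flow_sum en E2 x"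
    by (rule flow_sum_cong[OF fin(2)]) (use E in \<open>auto simp: ends_in_def shrink_def prod_eq_iff\<close>)
  also have "flow_sum (map_ends (shrink (- X) (fst (en e2))) en) E1 x = flow_sum en E1 x"
    by (rule flow_sum_cong[OF fin(1)]) (use E in \<open>auto simp: ends_in_def shrink_def prod_eq_iff\<close>)
  finally show ?thesis by (simp add: mult.commute)
qed auto

section \<open>Identification of \<open>flow_poly\<close> with the subgraph expansion\<close>

lemma connected_in_iff_conn: "connected_in G x y \<longleftrightarrow> conn (ends G) (edges G) x y"
  by (simp add: connected_in_def conn_def adj_def)

lemma edges_del_edge [simp]: "edges (del_edge G e) = edges G - {e}"
  and ends_del_edge [simp]: "ends (del_edge G e) = ends G"
  and verts_del_edge [simp]: "verts (del_edge G e) = verts G"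
  by (simp_all add: del_edge_def)

lemma edges_contr_edge [simp]: "edges (contr_edge G e) = edges G - {e}"
  and ends_contr_edge [simp]: "ends (contr_edge G e) = map_ends (shrink {snd (ends G e)} (fst (ends G e))) (ends G)"
  and verts_contr_edge [simp]: "verts (contr_edge G e) = verts G - {snd (ends G e)}"
  by (auto simp: contr_edge_def Let_def map_ends_def shrink_def fun_eq_iff)

lemma wf_del_edge: "wf_mgraph G \<Longrightarrow> wf_mgraph (del_edge G e)"
  by (auto simp: wf_mgraph_def)

lemma wf_contr_edge: "wf_mgraph G \<Longrightarrow> e \<in> edges G \<Longrightarrow> \<not> is_loop G e \<Longrightarrow> wf_mgraph (contr_edge G e)"
  by (auto simp: wf_mgraph_def is_loop_def shrink_def)

text \<open>A graph has no edges, or has a bridge, or has an edge at which a rule expresses its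
  value through graphs with fewer edges. Together with \<open>flow_rules_flow_sum\<close> this
  justifies the definite description in \<open>flow_poly\<close>.\<close>

lemma flow_rules_unique:
  assumes "flow_rules \<Phi>" "flow_rules \<Psi>" "wf_mgraph G"
  shows "\<Phi> G = \<Psi> G"
  using assms(3)
proof (induction "card (edges G)" arbitrary: G rule: less_induct)
  case less
  consider "edges G = {}" | "has_bridge G" | e where "e \<in> edges G" "is_loop G e"
    | e where "e \<in> edges G" "\<not> has_bridge G" "\<not> is_loop G e" by blast
  then show ?case
  proof cases
    case (3 e)
    have "card (edges (del_edge G e)) < card (edges G)"
      unfolding edges_del_edge using 3 less.prems by (intro card_Diff1_less) (auto simp: wf_mgraph_def)
    then have "\<Phi> (del_edge G e) = \<Psi> (del_edge G e)"
      using less.hyps less.prems by (simp only: wf_del_edge)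
    moreover have "\<Phi> G = [:-1, 1:] * \<Phi> (del_edge G e)" "\<Psi> G = [:-1, 1:] * \<Psi> (del_edge G e)"
      using assms(1,2) less.prems 3 unfolding flow_rules_def by blast+
    ultimately show ?thesis by simp
  next
    case (4 e)
    have "card (edges (del_edge G e)) < card (edges G)" "card (edges (contr_edge G e)) < card (edges G)"
      unfolding edges_del_edge edges_contr_edge
      using 4 less.prems by (intro card_Diff1_less; simp add: wf_mgraph_def)+
    note this[THEN less.hyps]
    then have "\<Phi> (del_edge G e) = \<Psi> (del_edge G e)" "\<Phi> (contr_edge G e) = \<Psi> (contr_edge G e)"
      using wf_del_edge[OF less.prems] wf_contr_edge[OF less.prems 4(1,3)] by simp_all
    moreover have "\<Phi> G = \<Phi> (contr_edge G e) - \<Phi> (del_edge G e)" "\<Psi> G = \<Psi> (contr_edge G e) - \<Psi> (del_edge G e)"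
      using assms(1,2) less.prems 4 unfolding flow_rules_def by blast+
    ultimately show ?thesis by simp
  qed (use assms(1,2) less.prems in \<open>simp_all add: flow_rules_def\<close>)
qed

lemma flow_rules_flow_sum: "flow_rules (\<lambda>G. flow_sum (ends G) (edges G) [:0, 1:])"
  unfolding flow_rules_def
proof (intro allI impI conjI ballI)
  fix G :: "('v, 'e) mgraph" assume wf: "wf_mgraph G"
  then have fin: "finite (edges G)" by (simp add: wf_mgraph_def)
  let ?F = "\<lambda>G. flow_sum (ends G) (edges G) ([:0, 1:] :: real poly)"
  show "?F G = 1" if "edges G = {}" using that by simp
  show "?F G = 0" if "has_bridge G"
  proof -
    from that obtain e where e: "e \<in> edges G" "\<not> conn (ends G) (edges G - {e}) (fst (ends G e)) (snd (ends G e))"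
      by (auto simp: has_bridge_def is_bridge_def connected_in_iff_conn)
    then have "flow_sum (ends G) (insert e (edges G - {e})) ([:0, 1:] :: real poly) = 0"
      using fin by (intro flow_sum_bridge) auto
    then show ?thesis using e by (simp add: insert_absorb)
  qed
  show "?F G = ?F (restrict_verts G W) * ?F (restrict_verts G (verts G - W))"
    if W: "W \<subseteq> verts G \<and> (\<forall>e\<in>edges G. fst (ends G e) \<in> W \<longleftrightarrow> snd (ends G e) \<in> W)" for W
  proof -
    have "edges G = edges (restrict_verts G W) \<union> edges (restrict_verts G (verts G - W))"
      using W wf by (auto simp: restrict_verts_def wf_mgraph_def)
    then have "?F G = flow_sum (ends G) (edges (restrict_verts G W) \<union> edges (restrict_verts G (verts G - W))) [:0, 1:]"
      by simp
    also have "\<dots> = flow_sum (ends G) (edges (restrict_verts G W)) [:0, 1:] * flow_sum (ends G) (edges (restrict_verts G (verts G - W))) [:0, 1:]"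
      by (rule flow_sum_disjoint[where X = W]) (use fin in \<open>auto simp: restrict_verts_def ends_in_def\<close>)
    finally show ?thesis by (simp add: restrict_verts_def)
  qed
  show "?F G = [:-1, 1:] * ?F (del_edge G e)" if "e \<in> edges G" "is_loop G e" for e
    using flow_sum_loop[of "edges G - {e}" e "ends G" "[:0, 1:] :: real poly"] that fin
    by (simp add: insert_absorb is_loop_def one_pCons)
  show "?F G = ?F (contr_edge G e) - ?F (del_edge G e)"
    if "e \<in> edges G" "\<not> has_bridge G \<and> \<not> is_loop G e" for e
    using flow_sum_contract[of "edges G - {e}" e "ends G" "[:0, 1:] :: real poly"] that fin
    by (simp add: insert_absorb is_loop_def)
qed

theorem flow_poly_eq_flow_sum:
  assumes "wf_mgraph G"
  shows "flow_poly G = flow_sum (ends G) (edges G) [:0, 1:]"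
  unfolding flow_poly_def
proof (rule the_equality)
  show "\<exists>\<Phi>. flow_rules \<Phi> \<and> \<Phi> G = flow_sum (ends G) (edges G) [:0, 1:]"
    using flow_rules_flow_sum by blast
qed (use flow_rules_unique[OF _ flow_rules_flow_sum assms] in blast)

lemma flow_sum_X_eq_monom:
  "flow_sum en E ([:0, 1:] :: 'a::comm_ring_1 poly) = (\<Sum>A\<in>Pow E. monom ((- 1) ^ card (E - A)) (nullity en A))"
proof -
  have "(- 1) ^ k * [:0, 1:] ^ n = monom ((- 1 :: 'a) ^ k) n" for k n
    by (cases "even k") (simp_all add: monom_altdef)
  then show ?thesis unfolding flow_sum_def by simp
qed

lemma poly_flow_sum: "poly (flow_sum en E p) z = flow_sum en E (poly p z)"
  by (simp add: flow_sum_def poly_sum)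

lemma map_poly_flow_sum:
  "map_poly complex_of_real (flow_sum en E [:0, 1:]) = flow_sum en E [:0, 1:]"
  by (rule poly_eqI) (auto simp: flow_sum_X_eq_monom coeff_map_poly coeff_sum intro!: sum.cong)

section \<open>3-edge-connected graphs\<close>

definition cut :: "('e \<Rightarrow> 'v \<times> 'v) \<Rightarrow> 'e set \<Rightarrow> 'v set \<Rightarrow> 'e set" where
  "cut en E X = {e \<in> E. crossing en X e}"

definition splits :: "'v set \<Rightarrow> 'v set \<Rightarrow> bool" where
  "splits X V \<longleftrightarrow> V \<inter> X \<noteq> {} \<and> V - X \<noteq> {}"

text \<open>An edge crosses a symmetric difference exactly when it crosses one of the two sets but
  not both; cuts form a vector space over the field with two elements.\<close>

lemma cut_sym_diff: "cut en E ((X - Y) \<union> (Y - X)) = (cut en E X - cut en E Y) \<union> (cut en E Y - cut en E X)"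
  by (auto simp: cut_def crossing_def)

lemma cut_splits: "e \<in> cut en E X \<Longrightarrow> splits X (endpoints en E)"
  by (auto simp: cut_def crossing_def splits_def endpoints_def)

text \<open>The component of \<open>x\<close> after deletion of \<open>B\<close> serves as
  \<open>X\<close>: only edges of \<open>B\<close> can leave it.\<close>

lemma separating_set:
  assumes "\<not> conn en (E - B) x y" "x \<in> V" "y \<in> V"
  shows "\<exists>X. splits X V \<and> cut en E X \<subseteq> B"
proof (intro exI conjI)
  let ?X = "Collect (conn en (E - B) x)"
  show "splits ?X V" using assms by (auto simp: splits_def)
  show "cut en E ?X \<subseteq> B"
  proof (rule subsetI, rule ccontr)
    fix e assume "e \<in> cut en E ?X" "e \<notin> B"
    then have "conn en (E - B) (fst (en e)) (snd (en e))" "crossing en ?X e"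
      by (auto simp: cut_def intro: conn_edge)
    then show False by (auto simp: crossing_def intro: conn_trans conn_sym)
  qed
qed

text \<open>Taking the endpoints of \<open>E\<close> as vertices keeps isolated vertices out. The
  bound on cuts includes connectedness, since an empty cut is too small.\<close>

locale three_edge_connected =
  fixes en :: "'e \<Rightarrow> 'v \<times> 'v" and E :: "'e set"
  assumes fin: "finite E"
    and nonempty: "E \<noteq> {}"
    and loopless: "e \<in> E \<Longrightarrow> fst (en e) \<noteq> snd (en e)"
    and cuts: "splits X (endpoints en E) \<Longrightarrow> 3 \<le> card (cut en E X)"
begin

abbreviation "V \<equiv> endpoints en E"
abbreviation "d \<equiv> nullity en E"

lemma finV: "finite V" by (rule finite_endpoints[OF fin])

lemma fin_cut: "finite (cut en E X)" using fin by (simp add: cut_def)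

lemma end_mem: "e \<in> E \<Longrightarrow> fst (en e) \<in> V" "e \<in> E \<Longrightarrow> snd (en e) \<in> V"
  by (auto simp: endpoints_def)

lemma conn_minus:
  assumes "card B < 3" "finite B" "x \<in> V" "y \<in> V"
  shows "conn en (E - B) x y"
proof (rule ccontr)
  assume "\<not> ?thesis"
  from separating_set[OF this assms(3,4)] obtain X where "splits X V" "cut en E X \<subseteq> B" by auto
  with cuts[of X] card_mono[OF assms(2)] assms(1) show False by (meson le_trans not_le)
qed

lemma nullity_eq: "d + card V = card E + 1"
proof -
  from nonempty obtain e where "e \<in> E" by auto
  then have v: "fst (en e) \<in> V" by (rule end_mem)
  have "Collect (conn en E x) = Collect (conn en E (fst (en e)))" if "x \<in> V" for x
    using conn_minus[of "{}" x "fst (en e)"] that v by (simp add: Collect_conn_eq_iff)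
  then have "(\<lambda>x. Collect (conn en E x)) ` V = (\<lambda>x. Collect (conn en E (fst (en e)))) ` V"
    by (rule image_cong[OF refl])
  also have "\<dots> = {Collect (conn en E (fst (en e)))}" using v by auto
  finally have "ncomp en V E = 1" by (simp add: ncomp_def)
  then show ?thesis using nullity_vertices[OF fin finV ends_in_endpoints[of en]] by simp
qed

lemma nullity_remove:
  assumes "e \<in> E" "e \<notin> B"
  shows "nullity en (E - B) = nullity en (E - insert e B) +
    (if conn en (E - insert e B) (fst (en e)) (snd (en e)) then 1 else 0)"
proof -
  have eq: "insert e (E - insert e B) = E - B" using assms by auto
  have "nullity en (insert e (E - insert e B)) = nullity en (E - insert e B) +
    (if conn en (E - insert e B) (fst (en e)) (snd (en e)) then 1 else 0)"
    by (rule nullity_insert) (use fin in auto)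
  then show ?thesis by (simp only: eq)
qed

lemma nullity_minus_1:
  assumes "e \<in> E" shows "nullity en (E - {e}) + 1 = d"
  using nullity_remove[OF assms, of "{}"] conn_minus[of "{e}"] end_mem[OF assms] by simp

lemma nullity_minus_2:
  assumes "B \<subseteq> E" "card B = 2" shows "nullity en (E - B) + 2 = d"
proof -
  obtain e f where B: "B = {e, f}" "e \<noteq> f" using assms(2) by (auto simp: card_2_iff)
  then show ?thesis
    using assms nullity_remove[of e "{f}"] conn_minus[of "{e, f}"] end_mem[of e] nullity_minus_1[of f] by simp
qed

text \<open>By \<open>nullity_minus_3\<close>, every member of this set is a 3-edge cut.\<close>

definition triads :: "'e set set" where
  "triads = {T. T \<subseteq> E \<and> card T = 3 \<and> nullity en (E - T) + 2 = d}"

text \<open>Deleting \<open>f\<close> and \<open>g\<close> costs two. Deleting \<open>e\<close>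
  costs a third unless \<open>e\<close> has become a bridge; in that case \<open>B\<close> contains
  a cut, which has at least three edges and so equals \<open>B\<close>.\<close>

lemma nullity_minus_3:
  assumes "B \<subseteq> E" "card B = 3" 
  shows "nullity en (E - B) + 2 = d \<and> (\<exists>X. cut en E X = B) \<or> nullity en (E - B) + 3 = d"
proof -
  obtain e f g where B: "B = {e, f, g}" "e \<noteq> f" "e \<noteq> g" "f \<noteq> g" using assms(2) by (auto simp: card_3_iff)
  have 2: "nullity en (E - {f, g}) + 2 = d" using nullity_minus_2[of "{f, g}"] assms B by auto
  show ?thesis
  proof (cases "conn en (E - B) (fst (en e)) (snd (en e))")
    case True
    then show ?thesis using 2 nullity_remove[of e "{f, g}"] B assms by simp
  next
    case False
    then obtain X where X: "splits X V" "cut en E X \<subseteq> B"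
      using separating_set[of en E B _ _ V] end_mem[of e] assms B by blast
    have "cut en E X = B"
      by (rule card_seteq) (use cuts[OF X(1)] X assms fin in \<open>auto intro: finite_subset\<close>)
    then show ?thesis using 2 nullity_remove[of e "{f, g}"] B assms False by auto
  qed
qed

text \<open>Three edges of \<open>B\<close> whose deletion costs three are enough. If
  \<open>{a, b, c}\<close> and \<open>{a, b, e}\<close> were both cuts, their symmetric difference
  \<open>{c, e}\<close> would be a cut with two edges.\<close>

lemma nullity_minus_4:
  assumes "B \<subseteq> E" "4 \<le> card B" 
  shows "nullity en (E - B) + 3 \<le> d"
proof -
  obtain T where T: "T \<subseteq> B" "card T = 4" using assms(2) obtain_subset_with_card_n by metis
  then obtain a b c e where abce: "T = {a, b, c, e}" "a \<noteq> b" "a \<noteq> c" "a \<noteq> e" "b \<noteq> c" "b \<noteq> e" "c \<noteq> e"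
    by (auto simp: card_Suc_eq numeral_eq_Suc)
  have mono: "nullity en (E - B) \<le> nullity en (E - U)" if "U \<subseteq> T" for U
    by (rule nullity_mono) (use that T fin in auto)
  have "nullity en (E - {a, b, c}) + 3 = d \<or> nullity en (E - {a, b, e}) + 3 = d"
  proof (rule ccontr)
    assume *: "\<not> ?thesis"
    obtain X where X: "cut en E X = {a, b, c}"
      using nullity_minus_3[of "{a, b, c}"] * abce T assms by auto
    obtain Y where Y: "cut en E Y = {a, b, e}"
      using nullity_minus_3[of "{a, b, e}"] * abce T assms by auto
    have ce: "cut en E ((X - Y) \<union> (Y - X)) = {c, e}"
      unfolding cut_sym_diff X Y using abce by auto
    then have "splits ((X - Y) \<union> (Y - X)) V"
      using cut_splits[of c en E] by simp
    then have "3 \<le> card {c, e}" using cuts ce by metis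
    then show False by (auto simp: card_insert_if split: if_splits)
  qed
  then show ?thesis using mono[of "{a, b, c}"] mono[of "{a, b, e}"] abce by auto
qed

lemma corank:
  assumes "B \<subseteq> E"
  shows "nullity en (E - B) \<le> d"
    and "nullity en (E - B) = d \<longleftrightarrow> B = {}"
    and "nullity en (E - B) + 1 = d \<longleftrightarrow> card B = 1"
    and "nullity en (E - B) + 2 = d \<longleftrightarrow> card B = 2 \<or> B \<in> triads"
proof -
  have finB: "finite B" using assms fin by (rule finite_subset)
  consider "B = {}" | "card B = 1" | "card B = 2" | "card B = 3" | "4 \<le> card B"
  proof -
    have "card B = 0 \<or> card B = 1 \<or> card B = 2 \<or> card B = 3 \<or> 4 \<le> card B" by linarith
    then show thesis using that finB by auto
  qed
  then have "nullity en (E - B) \<le> d \<and> (nullity en (E - B) = d \<longleftrightarrow> B = {}) \<and>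
    (nullity en (E - B) + 1 = d \<longleftrightarrow> card B = 1) \<and> (nullity en (E - B) + 2 = d \<longleftrightarrow> card B = 2 \<or> B \<in> triads)"
  proof cases
    case 2
    then obtain e where "B = {e}" by (auto simp: card_1_singleton_iff)
    then show ?thesis using nullity_minus_1[of e] assms by (auto simp: triads_def)
  next
    case 3 then show ?thesis using nullity_minus_2[OF assms] by (auto simp: triads_def)
  next
    case 4 then show ?thesis using nullity_minus_3[OF assms] assms by (auto simp: triads_def)
  next
    case 5 then show ?thesis using nullity_minus_4[OF assms] by (auto simp: triads_def)
  qed (auto simp: triads_def)
  then show "nullity en (E - B) \<le> d"
    and "nullity en (E - B) = d \<longleftrightarrow> B = {}"
    and "nullity en (E - B) + 1 = d \<longleftrightarrow> card B = 1"
    and "nullity en (E - B) + 2 = d \<longleftrightarrow> card B = 2 \<or> B \<in> triads" by blast+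
qed

section \<open>The three leading coefficients\<close>

lemma coeff_flow_sum:
  "coeff (flow_sum en E ([:0, 1:] :: 'a::comm_ring_1 poly)) i = (\<Sum>B\<in>{B. B \<subseteq> E \<and> nullity en (E - B) = i}. (- 1) ^ card B)"
proof -
  have "coeff (flow_sum en E ([:0, 1:] :: 'a poly)) i
    = (\<Sum>A\<in>Pow E. if nullity en A = i then (- 1) ^ card (E - A) else 0)"
    by (simp add: flow_sum_X_eq_monom coeff_sum)
  also have "\<dots> = (\<Sum>B\<in>Pow E. if nullity en (E - B) = i then (- 1) ^ card B else 0)"
    by (rule sum.reindex_bij_witness[of _ "\<lambda>B. E - B" "\<lambda>B. E - B"]) (auto simp: double_diff)
  also have "\<dots> = (\<Sum>B\<in>{B \<in> Pow E. nullity en (E - B) = i}. (- 1) ^ card B)"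
    by (rule sum.inter_filter[symmetric]) (use fin in simp)
  also have "{B \<in> Pow E. nullity en (E - B) = i} = {B. B \<subseteq> E \<and> nullity en (E - B) = i}" by auto
  finally show ?thesis .
qed

lemma coeff_top: "coeff (flow_sum en E [:0, 1:]) d = 1"
proof -
  have "{B. B \<subseteq> E \<and> nullity en (E - B) = d} = {{}}" using corank(2) by auto
  then show ?thesis by (simp add: coeff_flow_sum)
qed

lemma coeff_above: "d < i \<Longrightarrow> coeff (flow_sum en E [:0, 1:]) i = 0"
proof -
  assume "d < i"
  then have "{B. B \<subseteq> E \<and> nullity en (E - B) = i} = {}"
    using corank(1) by (metis (mono_tags, lifting) Collect_empty_eq not_le)
  then show ?thesis by (simp only: coeff_flow_sum sum.empty)
qed

lemma coeff_1:
  assumes "Suc i = d" shows "coeff (flow_sum en E [:0, 1:]) i = - of_nat (card E)"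
proof -
  have "nullity en (E - B) = i \<longleftrightarrow> card B = 1" if "B \<subseteq> E" for B
    using corank(3)[OF that] assms by linarith
  then have "{B. B \<subseteq> E \<and> nullity en (E - B) = i} = {B. B \<subseteq> E \<and> card B = 1}" by blast
  then show ?thesis using n_subsets[OF fin, of 1] by (simp add: coeff_flow_sum)
qed

text \<open>Two-element sets count with sign +1, and triads, having three elements, with sign
  -1.\<close>

lemma coeff_2:
  assumes "Suc (Suc i) = d"
  shows "coeff (flow_sum en E [:0, 1:]) i = of_nat (card E choose 2) - of_nat (card triads)"
proof -
  have "nullity en (E - B) = i \<longleftrightarrow> card B = 2 \<or> B \<in> triads" if "B \<subseteq> E" for B
    using corank(4)[OF that] assms by linarith
  then have "{B. B \<subseteq> E \<and> nullity en (E - B) = i} = {B. B \<subseteq> E \<and> card B = 2} \<union> triads"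
    by (auto simp: triads_def)
  moreover have "{B. B \<subseteq> E \<and> card B = 2} \<inter> triads = {}" by (auto simp: triads_def)
  moreover have "finite triads" "finite {B. B \<subseteq> E \<and> card B = 2}"
    using fin by (auto simp: triads_def intro: finite_subset[of _ "Pow E"])
  ultimately show ?thesis
    using n_subsets[OF fin, of 2] by (simp add: coeff_flow_sum sum.union_disjoint triads_def)
qed

section \<open>Vertex degrees\<close>

lemma card_V: "2 \<le> card V"
proof -
  from nonempty obtain e where "e \<in> E" by auto
  then have "{fst (en e), snd (en e)} \<subseteq> V" "card {fst (en e), snd (en e)} = 2"
    using loopless[of e] by (auto simp: endpoints_def)
  then show ?thesis using card_mono[OF finV] by metis
qed

lemma degree_ge_3: "x \<in> V \<Longrightarrow> 3 \<le> card (cut en E {x})"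
proof (rule cuts)
  assume "x \<in> V"
  moreover have "V - {x} \<noteq> {}"
  proof
    assume "V - {x} = {}"
    then have "card V \<le> card {x}" by (intro card_mono) auto
    then show False using card_V by simp
  qed
  ultimately show "splits {x} V" by (auto simp: splits_def)
qed

lemma handshake: "(\<Sum>x\<in>V. card (cut en E {x})) = 2 * card E"
proof -
  have "(\<Sum>x\<in>V. card (cut en E {x})) = (\<Sum>x\<in>V. \<Sum>e\<in>{e \<in> E. crossing en {x} e}. 1)"
    by (simp add: cut_def)
  also have "\<dots> = (\<Sum>e\<in>E. \<Sum>x\<in>{x \<in> V. crossing en {x} e}. 1)"
    by (rule sum.swap_restrict[OF finV fin])
  also have "\<dots> = (\<Sum>e\<in>E. 2)"
  proof (intro sum.cong refl)
    fix e assume e: "e \<in> E"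
    have "{x \<in> V. crossing en {x} e} = {fst (en e), snd (en e)}"
      using end_mem[OF e] loopless[OF e] by (auto simp: crossing_def)
    then show "(\<Sum>x\<in>{x \<in> V. crossing en {x} e}. 1) = (2::nat)" using loopless[OF e] by simp
  qed
  finally show ?thesis by simp
qed

lemma three_V: "3 * card V \<le> 2 * card E"
  using sum_mono[of V "\<lambda>_. 3" "\<lambda>x. card (cut en E {x})"] degree_ge_3 handshake by simp

end

locale three_cuts_trivial = three_edge_connected +
  assumes trivial: "card (cut en E X) = 3 \<Longrightarrow> {e \<in> E. fst (en e) \<in> X \<and> snd (en e) \<in> X} = {} \<or>
    {e \<in> E. fst (en e) \<notin> X \<and> snd (en e) \<notin> X} = {}"
begin

text \<open>One side of a 3-edge cut has no inner edge. A vertex on that side meets only cut edges,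
  and as its degree is at least three, its star is the whole cut.\<close>

lemma triads_stars: "triads \<subseteq> (\<lambda>x. cut en E {x}) ` V"
proof
  fix T assume T: "T \<in> triads"
  then obtain X where X: "cut en E X = T" "card T = 3"
    using nullity_minus_3[of T] by (auto simp: triads_def)
  then have "splits X V" using cut_splits[of _ en E X] by (metis card.empty ex_in_conv zero_neq_numeral)
  then obtain x y where xy: "x \<in> V" "x \<in> X" "y \<in> V" "y \<notin> X" by (auto simp: splits_def)
  have star: "T \<in> (\<lambda>x. cut en E {x}) ` V" if "z \<in> V" "cut en E {z} \<subseteq> T" for z
  proof -
    have "cut en E {z} = T"
      by (rule card_seteq) (use that X degree_ge_3[OF that(1)] fin_cut[of X] in auto)
    then show ?thesis using that by auto
  qed
  from trivial[of X] X consider "{e \<in> E. fst (en e) \<in> X \<and> snd (en e) \<in> X} = {}"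
    | "{e \<in> E. fst (en e) \<notin> X \<and> snd (en e) \<notin> X} = {}" by blast
  then show "T \<in> (\<lambda>x. cut en E {x}) ` V"
  proof cases
    case 1 then show ?thesis using star[OF xy(1)] xy X by (auto simp: cut_def crossing_def)
  next
    case 2 then show ?thesis using star[OF xy(3)] xy X by (auto simp: cut_def crossing_def)
  qed
qed

lemma card_triads: "card triads \<le> card V"
  using triads_stars finV by (meson card_image_le card_mono finite_imageI le_trans)

text \<open>Equality makes every star a triad, so every degree is three.\<close>

lemma cubic: assumes "card triads = card V" shows "2 * card E = 3 * card V"
proof -
  have "triads = (\<lambda>x. cut en E {x}) ` V"
    by (rule card_seteq) (use triads_stars finV assms card_image_le[OF finV, of "\<lambda>x. cut en E {x}"] in auto)
  then have "card (cut en E {x}) = 3" if "x \<in> V" for x using that by (auto simp: triads_def)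
  then show ?thesis using handshake by simp
qed

end

section \<open>Real-rooted polynomials\<close>

text \<open>Vieta's formulas for the first two elementary symmetric functions, the second one
  expressed by power sums through \<open>2 * e2 = p1^2 - p2\<close>.\<close>

lemma coeff_prod_linear:
  fixes M :: "'a::idom multiset"
  defines "p \<equiv> (\<Prod>z\<in>#M. [:- z, 1:])"
  shows "coeff p (size M) = 1" and "size M < i \<Longrightarrow> coeff p i = 0"
    and "Suc i = size M \<Longrightarrow> coeff p i = - sum_mset M"
    and "Suc (Suc i) = size M \<Longrightarrow> 2 * coeff p i = (sum_mset M)\<^sup>2 - (\<Sum>z\<in>#M. z\<^sup>2)"
proof -
  have "coeff p (size M) = 1 \<and> (\<forall>i>size M. coeff p i = 0) \<and>
    (\<forall>i. Suc i = size M \<longrightarrow> coeff p i = - sum_mset M) \<and>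
    (\<forall>i. Suc (Suc i) = size M \<longrightarrow> 2 * coeff p i = (sum_mset M)\<^sup>2 - (\<Sum>z\<in>#M. z\<^sup>2))"
    unfolding p_def
  proof (induction M)
    case (add z M)
    let ?q = "\<Prod>z\<in>#M. [:- z, 1:]"
    have co: "coeff (\<Prod>z\<in>#add_mset z M. [:- z, 1:]) i = (case i of 0 \<Rightarrow> 0 | Suc j \<Rightarrow> coeff ?q j) - z * coeff ?q i" for i
      by (cases i) simp_all
    have q: "coeff ?q (size M) = 1" "\<And>i. size M < i \<Longrightarrow> coeff ?q i = 0"
      "\<And>i. Suc i = size M \<Longrightarrow> coeff ?q i = - sum_mset M"
      "\<And>i. Suc (Suc i) = size M \<Longrightarrow> 2 * coeff ?q i = (sum_mset M)\<^sup>2 - (\<Sum>z\<in>#M. z\<^sup>2)"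
      using add.IH by blast+
    show ?case
    proof (intro conjI allI impI)
      fix i
      show "coeff (\<Prod>z\<in>#add_mset z M. [:- z, 1:]) i = - sum_mset (add_mset z M)"
        if "Suc i = size (add_mset z M)"
      proof (cases i)
        case 0
        then have "M = {#}" using that by simp
        then show ?thesis using 0 by simp
      next
        case (Suc j)
        then have "Suc j = size M" using that by simp
        then show ?thesis unfolding co Suc nat.case using q(1) q(3)[of j] by simp
      qed
      show "2 * coeff (\<Prod>z\<in>#add_mset z M. [:- z, 1:]) i = (sum_mset (add_mset z M))\<^sup>2 - (\<Sum>z\<in>#add_mset z M. z\<^sup>2)"
        if sz: "Suc (Suc i) = size (add_mset z M)"
      proof (cases i)
        case 0
        then obtain y where "M = {#y#}" using sz size_1_singleton_mset[of M] by auto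
        then show ?thesis using 0 by (simp add: power2_eq_square algebra_simps)
      next
        case (Suc j)
        then have j: "Suc (Suc j) = size M" "Suc i = size M" using that by simp_all
        have "2 * coeff (\<Prod>z\<in>#add_mset z M. [:- z, 1:]) i = 2 * coeff ?q j - 2 * (z * coeff ?q i)"
          unfolding co Suc nat.case by (simp add: algebra_simps)
        then show ?thesis unfolding q(4)[OF j(1)] q(3)[OF j(2)] by (simp add: power2_eq_square algebra_simps)
      qed
      show "coeff (\<Prod>z\<in>#add_mset z M. [:- z, 1:]) (size (add_mset z M)) = 1"
        unfolding co by (simp add: q)
      show "coeff (\<Prod>z\<in>#add_mset z M. [:- z, 1:]) i = 0" if "size (add_mset z M) < i"
        using that unfolding co by (cases i) (simp_all add: q)
    qed
  qed auto
  then show "coeff p (size M) = 1" and "size M < i \<Longrightarrow> coeff p i = 0"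
    and "Suc i = size M \<Longrightarrow> coeff p i = - sum_mset M"
    and "Suc (Suc i) = size M \<Longrightarrow> 2 * coeff p i = (sum_mset M)\<^sup>2 - (\<Sum>z\<in>#M. z\<^sup>2)" by blast+
qed

text \<open>The zeros in \<open>M\<close> split off a power of the variable, and the constant term
  of the remaining product is left. With integer coefficients this makes the product of the nonzero
  roots a nonzero integer.\<close>

lemma coeff_prod_linear_nonzero:
  fixes M :: "'a::idom multiset"
  shows "coeff (\<Prod>z\<in>#M. [:- z, 1:]) (count M 0) = (\<Prod>z\<in>#filter_mset (\<lambda>z. z \<noteq> 0) M. - z)"
proof -
  have "(\<Prod>z\<in>#M. [:- z, 1:]) =
    (\<Prod>z\<in>#filter_mset (\<lambda>z. z = 0) M. [:- z, 1:]) * (\<Prod>z\<in>#filter_mset (\<lambda>z. z \<noteq> 0) M. [:- z, 1:])"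
    unfolding prod_mset.union[symmetric] image_mset_union[symmetric] multiset_partition[symmetric] ..
  also have "filter_mset (\<lambda>z. z = 0) M = replicate_mset (count M 0) 0"
    by (simp add: filter_eq_replicate_mset)
  also have "(\<Prod>z\<in>#replicate_mset (count M 0) (0::'a). [:- z, 1:]) = monom 1 (count M 0)"
    by (simp add: monom_altdef)
  finally show ?thesis
    by (simp add: coeff_monom_mult poly_prod_mset flip: poly_0_coeff_0)
qed

text \<open>Summing \<open>ln (t^2) <= t^2 - 1\<close> bounds the logarithm of the squared product,
  which is nonnegative by the second assumption.\<close>

lemma size_le_sum_squares:
  fixes T :: "real multiset"
  assumes "\<And>t. t \<in># T \<Longrightarrow> t \<noteq> 0" "1 \<le> \<bar>\<Prod>t\<in>#T. t\<bar>"
  shows "real (size T) \<le> (\<Sum>t\<in>#T. t\<^sup>2)"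
proof -
  \<comment> \<open>That the product is nonzero is carried through the induction so that
    \<open>ln_mult\<close> applies.\<close>
  have "ln ((\<Prod>t\<in>#T. t)\<^sup>2) \<le> (\<Sum>t\<in>#T. t\<^sup>2) - real (size T) \<and> (\<Prod>t\<in>#T. t) \<noteq> 0"
    using assms(1)
  proof (induction T)
    case (add t T)
    have "t \<noteq> 0" using add.prems by simp
    moreover have "ln ((\<Prod>t\<in>#T. t)\<^sup>2) \<le> (\<Sum>t\<in>#T. t\<^sup>2) - real (size T)" "(\<Prod>t\<in>#T. t) \<noteq> 0"
      using add by auto
    moreover have "ln (t\<^sup>2) \<le> t\<^sup>2 - 1" using \<open>t \<noteq> 0\<close> by (intro ln_le_minus_one) simp
    ultimately show ?case by (simp add: power_mult_distrib ln_mult)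
  qed simp
  moreover have "0 \<le> ln ((\<Prod>t\<in>#T. t)\<^sup>2)"
    using assms(2) by (intro ln_ge_zero) (metis abs_1 abs_le_square_iff one_power2)
  ultimately show ?thesis by linarith
qed

lemma sum_mset_square_shift:
  fixes T :: "real multiset"
  shows "(\<Sum>t\<in>#T. (t - 1)\<^sup>2) = (\<Sum>t\<in>#T. t\<^sup>2) - 2 * sum_mset T + real (size T)"
  by (induction T) (simp_all add: power2_eq_square algebra_simps)

lemma sum_mset_squares_nonneg: "0 \<le> (\<Sum>t\<in>#T. (f t :: real)\<^sup>2)"
  by (induction T) auto

lemma sum_mset_square_zero:
  fixes T :: "real multiset"
  assumes "(\<Sum>t\<in>#T. (t - 1)\<^sup>2) \<le> 0" "t \<in># T"
  shows "t = 1"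
proof -
  obtain T' where "T = add_mset t T'" using assms(2) by (metis insert_DiffM)
  then have "(t - 1)\<^sup>2 + (\<Sum>t\<in>#T'. (t - 1)\<^sup>2) \<le> 0" using assms(1) by simp
  then have "(t - 1)\<^sup>2 \<le> 0"
    using sum_mset_squares_nonneg[of "\<lambda>t. t - 1" T'] by linarith
  then show ?thesis by simp
qed

text \<open>Here \<open>S\<close> consists of the flow roots minus 1, while \<open>n\<close>, \<open>m\<close> and \<open>g\<close> are the numbers of vertices,
  edges and 3-edge cuts; \<open>g = n\<close> is the cubic case.\<close>

lemma shifted_roots:
  fixes S :: "real multiset" and g n m :: nat
  assumes size: "size S + n = m + 1"
    and sum: "sum_mset S = real n - 1"
    and sq: "(\<Sum>s\<in>#S. s\<^sup>2) = 2 * real g - real n + 1"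
    and g: "g \<le> n" "g = n \<Longrightarrow> 2 * m = 3 * n"
    and zero: "0 \<in># S" and n: "2 \<le> n"
    and prod: "1 \<le> \<bar>\<Prod>s\<in>#filter_mset (\<lambda>s. s \<noteq> 0) S. s\<bar>"
    and "s \<in># S"
  shows "s \<in> {0, 1, 2}"
proof (cases "s = 0")
  case False
  define T q where "T = filter_mset (\<lambda>s. s \<noteq> 0) S" and "q = size T"
  have part: "S = replicate_mset (count S 0) 0 + T"
    unfolding T_def by (subst multiset_partition[of S "\<lambda>s. s = 0"]) (simp add: filter_eq_replicate_mset)
  have sT: "s \<in># T" using assms(9) False by (simp add: T_def)
  have q: "size S = count S 0 + q" unfolding q_def by (subst part) simp
  have sumT: "sum_mset T = real n - 1" using sum by (subst (asm) part) simp
  have sqT: "(\<Sum>s\<in>#T. s\<^sup>2) = 2 * real g - real n + 1" using sq by (subst (asm) part) simp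
  have "real q \<le> (\<Sum>s\<in>#T. s\<^sup>2)"
    unfolding q_def by (rule size_le_sum_squares) (use prod in \<open>auto simp: T_def\<close>)
  then have q_le: "real q \<le> 2 * real g - real n + 1" by (simp add: sqT)
  have dev: "(\<Sum>t\<in>#T. (t - 1)\<^sup>2) = 2 * real g - 3 * real n + 3 + real q"
    by (simp add: sum_mset_square_shift sumT sqT flip: q_def)
  have dev0: "0 \<le> (\<Sum>t\<in>#T. (t - 1)\<^sup>2)" by (rule sum_mset_squares_nonneg)
  show ?thesis
  proof (cases "g = n")
    case False
    then have "real g + 1 \<le> real n" using g(1) by simp
    then have "(\<Sum>t\<in>#T. (t - 1)\<^sup>2) \<le> 0" using dev q_le by linarith
    then show ?thesis using sum_mset_square_zero sT by simp
  next
    case True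
    \<comment> \<open>Here \<open>n = 2 * k\<close> and \<open>m = 3 * k\<close>, so
      \<open>S\<close> has \<open>k + 1\<close> elements; at least one is zero, which leaves
      \<open>q <= k\<close>.\<close>
    define k where "k = m - n"
    have k: "n = 2 * k" "size S = k + 1" "1 \<le> k" using g(2)[OF True] size n by (auto simp: k_def)
    have "1 \<le> count S 0" using zero by (simp add: Suc_le_eq)
    then have qk: "q \<le> k" using q k(2) by linarith
    have dev': "(\<Sum>t\<in>#T. (t - 1)\<^sup>2) = 3 - 2 * real k + real q" using dev True k by simp
    have "2 * k \<le> 3 + q" using dev0 dev' by linarith
    moreover have "0 < q" using sT unfolding q_def by (metis nonempty_has_size empty_not_add_mset insert_DiffM)
    \<comment> \<open>From \<open>2 * k <= 3 + q\<close> and \<open>q <= k\<close> it follows that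
      \<open>k <= 3\<close>.\<close>
    ultimately consider "q = 1" "k \<le> 2" | "q = 2" "k = 2" | "q = 3" "k = 3"
      using qk by linarith
    then show ?thesis
    proof cases
      case 1
      then obtain t where "T = {#t#}" unfolding q_def using size_1_singleton_mset by blast
      then have t: "T = {#s#}" using sT by simp
      \<comment> \<open>Both values of \<open>k\<close> are contradictory: \<open>s = 1\<close> with
        \<open>s^2 = 3\<close>, or \<open>s = 3\<close> with \<open>s^2 = 5\<close>.\<close>
      have "s = 2 * real k - 1" "s\<^sup>2 = 2 * real k + 1" using sumT sqT True k unfolding t by simp_all
      moreover have "k = 1 \<or> k = 2" using 1 k by linarith
      ultimately show ?thesis by auto
    next
      case 2
      obtain T' where T': "T = add_mset s T'" using sT by (metis insert_DiffM)
      then have "size T' = 1" using 2 q_def by simp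
      then obtain t where "T' = {#t#}" using size_1_singleton_mset by blast
      then have "s + t = 3" "s\<^sup>2 + t\<^sup>2 = 5" using sumT sqT True k 2 T' by simp_all
      then have "s\<^sup>2 + (3 - s)\<^sup>2 = 5" by (metis add_diff_cancel_left')
      then have "(s - 1) * (s - 2) = 0" by (simp add: power2_eq_square algebra_simps)
      then show ?thesis by auto
    next
      case 3
      \<comment> \<open>All three elements would equal 1 and sum to 3, whereas the sum is
        \<open>n - 1 = 5\<close>.\<close>
      then have "(\<Sum>t\<in>#T. (t - 1)\<^sup>2) \<le> 0" using dev' by simp
      then have "t = 1" if "t \<in># T" for t using sum_mset_square_zero that by blast
      then have "T = replicate_mset q 1" unfolding q_def by (metis set_mset_subset_singletonD singleton_iff subsetI size_replicate_mset)
      then show ?thesis using sumT 3 k by simp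
    qed
  qed
qed simp

section \<open>Integrality of the coefficients\<close>

lemma Ints_coeff_mult:
  fixes p q :: "'a::comm_ring_1 poly"
  assumes "\<And>i. coeff p i \<in> \<int>" "\<And>i. coeff q i \<in> \<int>" shows "coeff (p * q) i \<in> \<int>"
  unfolding coeff_mult by (intro Ints_sum Ints_mult assms)

lemma Ints_coeff_power:
  fixes p :: "'a::comm_ring_1 poly"
  assumes "\<And>i. coeff p i \<in> \<int>" shows "coeff (p ^ n) i \<in> \<int>"
proof (induction n arbitrary: i)
  case 0 then show ?case by (simp add: coeff_1)
next
  case (Suc n)
  then show ?case unfolding power_Suc by (intro Ints_coeff_mult assms)
qed

lemma Ints_coeff_flow_sum:
  fixes p :: "'a::comm_ring_1 poly"
  assumes "\<And>i. coeff p i \<in> \<int>" shows "coeff (flow_sum en E p) i \<in> \<int>"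
proof -
  have "coeff (- 1 :: 'a poly) i \<in> \<int>" for i by (simp add: coeff_1)
  then show ?thesis
    unfolding flow_sum_def coeff_sum
    by (intro Ints_sum Ints_coeff_mult Ints_coeff_power assms)
qed

lemma of_real_flow_sum: "of_real (flow_sum en E x) = flow_sum en E (of_real x)"
  by (simp add: flow_sum_def)

section \<open>Real-rooted flow polynomials\<close>

context three_edge_connected
begin

text \<open>The polynomial is factored over the complex numbers, its roots are read as reals, and
  the two real polynomials are compared at every real point.\<close>

lemma real_rooted_factorization:
  assumes real: "\<And>z::complex. flow_sum en E z = 0 \<Longrightarrow> z \<in> \<real>"
  obtains R :: "real multiset" where "size R = d" "flow_sum en E [:0, 1:] = (\<Prod>r\<in>#R. [:- r, 1:])"
proof -
  define p :: "complex poly" where "p = flow_sum en E [:0, 1:]"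
  have pz: "poly p z = flow_sum en E z" for z by (simp add: p_def poly_flow_sum)
  have "degree p = d"
    unfolding p_def by (intro antisym degree_le le_degree) (simp_all add: coeff_above coeff_top)
  then have lead: "lead_coeff p = 1" by (simp add: p_def coeff_top)
  then have "p \<noteq> 0" by auto
  define R where "R = image_mset Re (proots p)"
  have "z = of_real (Re z)" if "z \<in># proots p" for z
    using that real[of z] pz \<open>p \<noteq> 0\<close> by (simp add: complex_is_Real_iff complex_eq_iff)
  then have proots: "proots p = image_mset of_real R"
    unfolding R_def image_mset.compositionality by (metis (no_types, lifting) comp_def multiset.map_cong0 multiset.map_id0 id_def)
  have p: "p = (\<Prod>z\<in>#proots p. [:- z, 1:])"
    using complex_poly_decompose_multiset[of p] lead by simp
  have "poly (flow_sum en E [:0, 1:]) y = poly (\<Prod>r\<in>#R. [:- r, 1:]) y" for y :: real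
  proof -
    have "complex_of_real (flow_sum en E y) = poly p (of_real y)" by (simp add: pz of_real_flow_sum)
    also have "\<dots> = (\<Prod>r\<in>#R. of_real y - of_real r)"
      by (subst p) (simp add: proots poly_prod_mset image_mset.compositionality comp_def)
    also have "\<dots> = of_real (\<Prod>r\<in>#R. y - r)" by (induction R) auto
    finally have "flow_sum en E y = (\<Prod>r\<in>#R. y - r)" by (simp only: of_real_eq_iff)
    then show ?thesis by (simp add: poly_flow_sum poly_prod_mset)
  qed
  then have "flow_sum en E [:0, 1:] = (\<Prod>r\<in>#R. [:- r, 1:])" by (metis ext poly_eq_poly_eq_iff)
  moreover have "size R = d" using size_proots_complex[of p] \<open>degree p = d\<close> by (simp add: R_def)
  ultimately show ?thesis using that by blast
qed

end

context three_cuts_trivial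
begin

lemma core_roots:
  assumes real: "\<And>z::complex. flow_sum en E z = 0 \<Longrightarrow> z \<in> \<real>" and root: "flow_sum en E (w::complex) = 0"
  shows "w \<in> {1, 2, 3}"
proof -
  obtain R where R: "size R = d" "flow_sum en E [:0, 1:] = (\<Prod>r\<in>#R. [:- r, 1::real:])"
    using real by (rule real_rooted_factorization)
  have flow: "flow_sum en E y = (\<Prod>r\<in>#R. y - r)" for y :: real
    using arg_cong[OF R(2), of "\<lambda>p. poly p y"] by (simp add: poly_flow_sum poly_prod_mset)
  have root_iff: "flow_sum en E y = 0 \<longleftrightarrow> y \<in># R" for y :: real
    unfolding flow by (auto simp: prod_mset_zero_iff)
  define n m g where "n = card V" and "m = card E" and "g = card triads"
  have nm: "d + n = m + 1" "3 * n \<le> 2 * m" "2 \<le> n" "g \<le> n"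
    using nullity_eq three_V card_V card_triads by (simp_all add: n_def m_def g_def)
  \<comment> \<open>\<open>3 * n <= 2 * m\<close> and \<open>2 <= n\<close> give
    \<open>2 <= d\<close>, so the second and third coefficients exist.\<close>
  then have "Suc (Suc (d - 2)) = d" by linarith
  then obtain i where i: "Suc (Suc i) = d" by blast
  have sumR: "sum_mset R = real m"
    using coeff_prod_linear(3)[of "Suc i" R] coeff_1[of "Suc i", where 'a = real] i R by (simp add: m_def)
  have "2 * (real (m choose 2) - real g) = (sum_mset R)\<^sup>2 - (\<Sum>r\<in>#R. r\<^sup>2)"
    using coeff_prod_linear(4)[of i R] coeff_2[of i, where 'a = real] i R by (simp add: m_def g_def)
  moreover have "2 * real (m choose 2) = real m * (real m - 1)"
    using nm by (simp add: choose_two real_of_nat_div of_nat_diff)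
  ultimately have sqR: "(\<Sum>r\<in>#R. r\<^sup>2) = real m + 2 * real g"
    by (simp add: sumR power2_eq_square algebra_simps)
  define S where "S = image_mset (\<lambda>r. r - 1) R"
  have size: "size S = d" by (simp add: S_def R)
  have "sum_mset S = sum_mset R - real (size R)" unfolding S_def by (induction R) auto
  then have sumS: "sum_mset S = real n - 1" using nm R by (simp add: sumR)
  have "(\<Sum>s\<in>#S. s\<^sup>2) = (\<Sum>r\<in>#R. r\<^sup>2) - 2 * sum_mset R + real (size R)"
    unfolding S_def image_mset.compositionality comp_def by (rule sum_mset_square_shift)
  then have sqS: "(\<Sum>s\<in>#S. s\<^sup>2) = 2 * real g - real n + 1" using nm R by (simp add: sumR sqR)
  have "flow_sum en E (1::real) = 0" by (rule flow_sum_one[OF fin nonempty])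
  then have zero: "0 \<in># S" by (auto simp: S_def root_iff)
  let ?T = "filter_mset (\<lambda>s. s \<noteq> 0) S"
  \<comment> \<open>Evaluation at \<open>[:1, 1:]\<close> translates the variable by one: the roots
    become the elements of \<open>S\<close>, and the coefficients remain integers.\<close>
  have "poly (flow_sum en E [:1, 1:]) y = poly (\<Prod>s\<in>#S. [:- s, 1:]) y" for y :: real
    by (simp add: poly_flow_sum flow poly_prod_mset S_def image_mset.compositionality comp_def algebra_simps)
  then have "flow_sum en E [:1, 1:] = (\<Prod>s\<in>#S. [:- s, 1:])" by (metis ext poly_eq_poly_eq_iff)
  moreover have "coeff (flow_sum en E [:1, 1::real:]) (count S 0) \<in> \<int>"
    by (rule Ints_coeff_flow_sum) (simp add: coeff_pCons split: nat.split)
  ultimately have "(\<Prod>s\<in>#?T. - s) \<in> \<int>" by (simp add: coeff_prod_linear_nonzero)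
  moreover have "(\<Prod>s\<in>#?T. - s) \<noteq> 0" by (auto simp: prod_mset_zero_iff)
  ultimately have "1 \<le> \<bar>\<Prod>s\<in>#?T. - s\<bar>" by (rule Ints_nonzero_abs_ge1)
  moreover have "\<bar>\<Prod>s\<in>#M. - s\<bar> = \<bar>\<Prod>s\<in>#M. s\<bar>" for M :: "real multiset"
    by (induction M) (simp_all add: abs_mult)
  ultimately have prod: "1 \<le> \<bar>\<Prod>s\<in>#?T. s\<bar>" by simp
  have "w \<in> \<real>" using root by (rule real)
  then obtain y where y: "w = of_real y" by (auto elim: Reals_cases)
  have "of_real (flow_sum en E y) = (0::complex)" using root by (simp add: of_real_flow_sum y)
  then have "y \<in># R" by (simp add: root_iff)
  then have mem: "y - 1 \<in># S" by (auto simp: S_def)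
  have "y - 1 \<in> {0, 1, 2}"
    by (rule shifted_roots[OF _ sumS sqS _ _ zero _ prod mem, of m])
      (use nm size cubic in \<open>auto simp: n_def m_def g_def\<close>)
  then show ?thesis using y by auto
qed

end

text \<open>Induction on the number of edges with the end map left general, since contractions
  change it. Real-rootedness passes on because the roots of each smaller graph are flow roots of
  \<open>E\<close> or, at a 3-edge cut, possibly 1 or 2.\<close>

theorem real_rooted_flow_sum:
  fixes en :: "'e \<Rightarrow> 'v \<times> 'v" and w :: complex
  assumes "finite E" "\<And>z::complex. flow_sum en E z = 0 \<Longrightarrow> z \<in> \<real>" "flow_sum en E w = 0"
  shows "w \<in> {1, 2, 3}"
  using assms
proof (induction "card E" arbitrary: E en w rule: less_induct)
  case less
  note fin = less.prems(1) and real = less.prems(2) and root = less.prems(3)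
  have IH: "z \<in> {1, 2, 3}"
    if "flow_sum en' E' z = 0" "card E' < card E" "finite E'" "\<And>z::complex. flow_sum en' E' z = 0 \<Longrightarrow> z \<in> \<real>"
    for en' :: "'e \<Rightarrow> 'v \<times> 'v" and E' and z :: complex
    by (rule less.hyps[OF that(2,3)]) (use that(1,4) in auto)
  have smaller: "card E' < card E" "finite E'" if "E' \<subset> E" for E'
    using that fin by (auto intro: psubset_card_mono dest: finite_subset)
  show ?case
  proof (cases "\<exists>e\<in>E. fst (en e) = snd (en e)")
    case True
    then obtain e where e: "e \<in> E" "fst (en e) = snd (en e)" by blast
    have F: "flow_sum en E z = (z - 1) * flow_sum en (E - {e}) z" for z :: complex
      using flow_sum_loop[of "E - {e}" e en z] e fin by (simp add: insert_absorb)
    have sm: "E - {e} \<subset> E" using e by auto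
    show ?thesis
    proof (cases "w = 1")
      case False
      then have "flow_sum en (E - {e}) w = 0" using root F by simp
      then show ?thesis by (rule IH) (use smaller[OF sm] real F in auto)
    qed simp
  next
    case loopless: False
    consider "E = {}" | X where "splits X (endpoints en E)" "card (cut en E X) \<le> 2"
      | X where "card (cut en E X) = 3" "{e \<in> E. fst (en e) \<in> X \<and> snd (en e) \<in> X} \<noteq> {}"
          "{e \<in> E. fst (en e) \<notin> X \<and> snd (en e) \<notin> X} \<noteq> {}"
      | "three_cuts_trivial en E"
    proof -
      assume *: "E = {} \<Longrightarrow> thesis" "\<And>X. splits X (endpoints en E) \<Longrightarrow> card (cut en E X) \<le> 2 \<Longrightarrow> thesis"
        "\<And>X. card (cut en E X) = 3 \<Longrightarrow> {e \<in> E. fst (en e) \<in> X \<and> snd (en e) \<in> X} \<noteq> {} \<Longrightarrow>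
          {e \<in> E. fst (en e) \<notin> X \<and> snd (en e) \<notin> X} \<noteq> {} \<Longrightarrow> thesis"
        "three_cuts_trivial en E \<Longrightarrow> thesis"
      show thesis
      proof (rule ccontr)
        assume "\<not> thesis"
        have "three_cuts_trivial en E"
        proof
          show "finite E" by (rule fin)
          show "E \<noteq> {}" using *(1) \<open>\<not> thesis\<close> by blast
          show "fst (en e) \<noteq> snd (en e)" if "e \<in> E" for e using loopless that by blast
          show "3 \<le> card (cut en E X)" if "splits X (endpoints en E)" for X
            using *(2)[OF that] \<open>\<not> thesis\<close> by linarith
          show "{e \<in> E. fst (en e) \<in> X \<and> snd (en e) \<in> X} = {} \<or> {e \<in> E. fst (en e) \<notin> X \<and> snd (en e) \<notin> X} = {}"
            if "card (cut en E X) = 3" for X using *(3)[OF that] \<open>\<not> thesis\<close> by blast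
        qed
        then show False using *(4) \<open>\<not> thesis\<close> by blast
      qed
    qed
    then show ?thesis
    proof cases
      case 1
      then show ?thesis using root by simp
    next
      case (2 X)
      define E1 E2 where "E1 = {e \<in> E. fst (en e) \<in> X \<and> snd (en e) \<in> X}"
        and "E2 = {e \<in> E. fst (en e) \<notin> X \<and> snd (en e) \<notin> X}"
      have fin_cut: "finite (cut en E X)" using fin by (simp add: cut_def)
      consider "card (cut en E X) = 0" | "card (cut en E X) = 1" | "card (cut en E X) = 2" using 2 by linarith
      then show ?thesis
      proof cases
        case 1
        then have no: "cut en E X = {}" using fin_cut by simp
        then have E: "E = E1 \<union> E2" by (auto simp: E1_def E2_def cut_def crossing_def)
        obtain x y where "x \<in> endpoints en E" "x \<in> X" "y \<in> endpoints en E" "y \<notin> X"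
          using 2 by (auto simp: splits_def)
        then have "E1 \<noteq> {}" "E2 \<noteq> {}" "E1 \<inter> E2 = {}"
          using no by (auto simp: E1_def E2_def cut_def crossing_def endpoints_def)
        then have sm: "E1 \<subset> E" "E2 \<subset> E" using E by auto
        have F: "flow_sum en E z = flow_sum en E1 z * flow_sum en E2 z" for z :: complex
          unfolding E by (rule flow_sum_disjoint[where X = X])
            (use smaller(2)[OF sm(1)] smaller(2)[OF sm(2)] in \<open>auto simp: E1_def E2_def ends_in_def\<close>)
        from root F consider "flow_sum en E1 w = 0" | "flow_sum en E2 w = 0" by auto
        then show ?thesis
        proof cases
          case 1 then show ?thesis by (rule IH) (use smaller[OF sm(1)] real F in auto)
        next
          case 2 then show ?thesis by (rule IH) (use smaller[OF sm(2)] real F in auto)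
        qed
      next
        case 1: 2
        then obtain e where e: "cut en E X = {e}" by (auto simp: card_1_singleton_iff)
        \<comment> \<open>A bridge makes the flow sum vanish everywhere, also at the imaginary unit,
          against real-rootedness.\<close>
        have "flow_sum en E \<i> = 0"
          by (rule flow_sum_cut_edge[where e = e and Y = X]) (use fin e in \<open>auto simp: cut_def crossing_def\<close>)
        then have "\<i> \<in> \<real>" by (rule real)
        then show ?thesis by (simp add: complex_is_Real_iff)
      next
        case 3
        then obtain e f where ef: "cut en E X = {e, f}" "e \<noteq> f" by (auto simp: card_2_iff)
        then have "e \<in> E" by (auto simp: cut_def)
        let ?en = "map_ends (shrink {snd (en e)} (fst (en e))) en"
        \<comment> \<open>Deleting \<open>e\<close> turns \<open>f\<close> into a bridge, so only
          the contraction term survives.\<close>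
        have F: "flow_sum en E z = flow_sum ?en (E - {e}) z" for z :: complex
        proof -
          have "flow_sum en (E - {e}) z = 0"
            by (rule flow_sum_cut_edge[where e = f and Y = X]) (use fin ef in \<open>auto simp: cut_def crossing_def\<close>)
          then show ?thesis
            using flow_sum_contract[of "E - {e}" e en z] fin loopless \<open>e \<in> E\<close> by (auto simp: insert_absorb)
        qed
        have sm: "E - {e} \<subset> E" using \<open>e \<in> E\<close> by auto
        from root have "flow_sum ?en (E - {e}) w = 0" by (simp add: F)
        then show ?thesis by (rule IH) (use smaller[OF sm] real F in auto)
      qed
    next
      case (3 X)
      define E1 E2 S where "E1 = {e \<in> E. fst (en e) \<in> X \<and> snd (en e) \<in> X}"
        and "E2 = {e \<in> E. fst (en e) \<notin> X \<and> snd (en e) \<notin> X}" and "S = cut en E X"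
      \<comment> \<open>The inner edges provide the vertices \<open>a\<close> and \<open>b\<close>,
        and each is missing from one of the contracted graphs, which therefore have fewer
        edges.\<close>
      obtain e1 e2 where "e1 \<in> E1" "e2 \<in> E2" using 3 by (auto simp: E1_def E2_def)
      define a b where "a = fst (en e1)" and "b = fst (en e2)"
      have ab: "a \<in> X" "b \<notin> X" using \<open>e1 \<in> E1\<close> \<open>e2 \<in> E2\<close> by (auto simp: E1_def E2_def a_def b_def)
      have E: "E = E1 \<union> S \<union> E2" by (auto simp: E1_def E2_def S_def cut_def crossing_def)
      have sm: "S \<union> E2 \<subset> E" "E1 \<union> S \<subset> E"
        using \<open>e1 \<in> E1\<close> \<open>e2 \<in> E2\<close> by (auto simp: E1_def E2_def S_def cut_def crossing_def)
      let ?ena = "map_ends (shrink X a) en" and ?enb = "map_ends (shrink (- X) b) en"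
      have F: "(z - 1) * (z - 2) * flow_sum en E z = flow_sum ?ena (S \<union> E2) z * flow_sum ?enb (E1 \<union> S) z" for z :: complex
      proof -
        have "flow_sum (map_ends (shrink X a) ?enb) S z = (z - 1) * (z - 2)"
          by (rule flow_sum_triple_edge[where a = a and b = b])
            (use 3(1) ab in \<open>auto simp: S_def cut_def crossing_def map_ends_def shrink_def\<close>)
        moreover have "flow_sum (map_ends (shrink X a) ?enb) S z * flow_sum en (E1 \<union> S \<union> E2) z
          = flow_sum ?ena (S \<union> E2) z * flow_sum ?enb (E1 \<union> S) z"
          by (rule flow_sum_cut[OF _ _ _ _ _ _ _ _ _ _ ab])
            (use fin 3(1) in \<open>auto simp: E1_def E2_def S_def cut_def crossing_def ends_in_def\<close>)
        ultimately show ?thesis by (simp flip: E)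
      qed
      have real': "z \<in> \<real>" if "flow_sum ?ena (S \<union> E2) z * flow_sum ?enb (E1 \<union> S) z = 0" for z :: complex
        using F[of z] that real[of z] by auto
      from root F[of w] consider "flow_sum ?ena (S \<union> E2) w = 0" | "flow_sum ?enb (E1 \<union> S) w = 0" by auto
      then show ?thesis
      proof cases
        case 1 then show ?thesis by (rule IH) (use smaller[OF sm(1)] real' in auto)
      next
        case 2 then show ?thesis by (rule IH) (use smaller[OF sm(2)] real' in auto)
      qed
    next
      case 4
      then show ?thesis using three_cuts_trivial.core_roots real root by blast
    qed
  qed
qed

theorem theorem5p5:
  fixes G :: "('v, 'e) mgraph"
  assumes "wf_mgraph G"
    and "\<not> has_bridge G"
    and "\<forall>z::complex. poly (map_poly complex_of_real (flow_poly G)) z = 0 \<longrightarrow> z \<in> \<real>"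
    and "card (edges G) \<le> card (verts G) + 16 \<or> roots12_count G \<le> 8"
  shows "\<forall>z::complex. poly (map_poly complex_of_real (flow_poly G)) z = 0 \<longrightarrow> z \<in> {1, 2, 3}"
proof -
  have "poly (map_poly complex_of_real (flow_poly G)) z = flow_sum (ends G) (edges G) z" for z
    by (simp add: flow_poly_eq_flow_sum[OF assms(1)] map_poly_flow_sum poly_flow_sum)
  moreover have "finite (edges G)" using assms(1) by (simp add: wf_mgraph_def)
  ultimately show ?thesis using real_rooted_flow_sum[of "edges G" "ends G"] assms(3) by presburger
qed

end
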